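(* Consider the stochastic LTI system, offline data, multi-step predictor $K$, least-squares predictor $\hat K$, distributions $\bar{\mathbb{P}}_{y_f\mid m_f}$, $\mathbb{P}_{y_f\mid m_f}$ and data-generating measure $\mathbb{P}$ described in the context. Let $r\in[1,\infty)$. Assume: (1) $(A,C)$ is observable and $T_p\ge n$; (2) $\gamma:(0,1)\to(0,\infty)$ is such that $\mathbb{P}\big(\|K-\hat K\|_r\le\gamma(\alpha')\big)\ge1-\alpha'$ for every confidence parameter $\alpha'\in(0,1)$; (3) $\mathbb{E}_{\mathbb{P}_{y_f\mid m_f}}[\|y_f\|_r^q]<\infty$ for some $q>r$; (4) $f_2,h:\mathbb{R}^{pT_f}\to\mathbb{R}$ are convex and Lipschitz continuous with constants $L_{\mathrm{obj}}>0$ and $L_{\mathrm{con}}>0$ with respect to $\|\cdot\|_r$. Let $f_1:\mathbb{R}^{mT_f}\to\mathbb{R}$, $\mathcal{U}\subseteq\mathbb{R}^{mT_f}$, $\beta\in(0,1)$, let $\alpha\in(0,1)$ be a risk level, and define $$\varepsilon(\alpha,m_f):=\varepsilon_1(\alpha)\Big(\frac1N\sum_{i=1}^N\|Me_i-m_f\|_r^r\Big)^{1/r}+\varepsilon_2(\alpha),\qquad \varepsilon_1(\alpha):=\gamma\big(\tfrac\alpha2\big),\qquad \varepsilon_2(\alpha):=\Big(\frac{2\,\Gamma(N)}{\alpha}\Big)^{1/r},$$ where, with $d=pT_f$, $$\Gamma(N)=C_0\begin{cases}N^{-1/2}+N^{-(q-r)/q}, & r>d/2,\\ N^{-1/2}\log(1+N)+N^{-(q-r)/q},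 & r=d/2,\\ N^{-r/d}+N^{-(q-r)/q}, & r\in(0,d/2),\end{cases}$$ and $C_0>0$ is a constant for which $\mathbb{E}_{\mathbb{P}}\big[d_{W_r}^r(\bar{\mathbb{P}}_{y_f\mid m_f},\mathbb{P}_{y_f\mid m_f})\big]\le\Gamma(N)$ holds for all $N\ge1$. Let $g^\star$ be (the $g$-component of) a feasible solution of $$\begin{aligned}\min_{g,\,\tau,\,s_1,\dots,s_N}\;& f_1(U_fg)+\frac1N\sum_{i=1}^N f_2\big(Y_fg+Y_f(I-P)e_i\big)+L_{\mathrm{obj}}\,\varepsilon\\ \text{s.t. }& U_pg=u_p,\quad Y_pg=y_p,\quad (I-P)g=0,\quad U_fg\in\mathcal{U},\\ &-\tau\beta+L_{\mathrm{con}}\,\varepsilon+\frac1N\sum_{i=1}^N s_i\le 0,\\ &\tau+h\big(Y_fg+Y_f(I-P)e_i\big)\le s_i,\quad s_i\ge0,\quad i=1,\dots,N,\end{aligned}$$ with $\varepsilon=\varepsilon(\alpha,m_f)$, where $m_f=[u_p^\top\;y_p^\top\;(U_fg)^\top]^\top$ and $P=M^\dagger M$. Let $\hat J(g^\star)$ be the objective value of this problem at $g^\star$, and define the true expected cost $J(g):=\mathbb{E}_{\mathbb{P}_{y_f\mid m_f}}[f_1(U_fg)+f_2(y_f)]$. Then $$\mathbb{P}\big\{J(g^\star)\le\hat J(g^\star)\big\}\ge1-\alpha,\qquad \mathbb{P}\big\{\mathrm{CVaR}^{1-\beta}_{\mathbb{P}_{y_f\mid m_f}}(h(y_f))\le0\big\}\ge1-\alpha,$$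 where in both statements $m_f$ is evaluated at $g=g^\star$.
   Context: System. $x_{k+1}=Ax_k+Bu_k+w_k$, $y_k=Cx_k+Du_k+v_k$, with $x_k\in\mathbb{R}^n$, $u_k\in\mathbb{R}^m$, $y_k\in\mathbb{R}^p$; the noise pairs $(w_k,v_k)$ are i.i.d. over time, $w_k\sim\mathbb{P}_w$, $v_k\sim\mathbb{P}_v$ (unknown). For a sequence write $z_{[k,j]}=[z_k^\top\cdots z_j^\top]^\top$. For horizons $T_p,T_f\ge1$ and time $k$ write $u_p=u_{[k-T_p,k-1]}$, $u_f=u_{[k,k+T_f-1]}$, and similarly $y_p,y_f,w_p,w_f,v_p,v_f$. Multi-step predictor. With $(A,C)$ observable and $T_p\ge n$, eliminating the initial state gives $y_f=Km_f+\xi_f$, $m_f=[u_p^\top\;y_p^\top\;u_f^\top]^\top$. Explicitly: write $y_p=O_px_{k-T_p}+S_pu_p+G_pw_p+v_p$, $x_k=A^{T_p}x_{k-T_p}+R_uu_p+R_ww_p$, $y_f=O_fx_k+S_fu_f+G_fw_f+v_f$ (matrices obtained by iterating the system; $O_p,O_f$ are the extended observability matrices of $T_p$ and $T_f$ block rows), and let $O_p^{+}$ be a fixed left inverse of $O_p$ (e.g. Moore-Penrose). Then $K=[\,O_f(R_u-A^{T_p}O_p^+S_p)\;\;\;O_fA^{T_p}O_p^+\;\;\;S_f\,]$ and $\xi_f=O_f(R_w-A^{T_p}O_p^+G_p)w_p-O_fA^{T_p}O_p^+v_p+G_fw_f+v_f$. The law of $\xi_f$ is $\mathbb{P}_{\xi_f}$;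 $\mathbb{P}_{y_f\mid m_f}$ denotes the distribution of $y_f$ for fixed $m_f$, i.e. of $Km_f+\xi_f$ with $\xi_f\sim\mathbb{P}_{\xi_f}$. Offline data. A trajectory $\{u_k^d,y_k^d\}_{k=1}^T$ of the system; $\mathbb{P}$ is the joint measure of the initial state and noise sequences generating it. The current past data $u_p,y_p$ in the optimization problem are given and fixed. $L=T_p+T_f$, $N=T-L+1$. $H_L(z)=[z_{[1,L]}\;\cdots\;z_{[T-L+1,T]}]$ is the Hankel matrix; $H_L(u^d)=\begin{bmatrix} U_p \\ U_f \end{bmatrix}$, $H_L(y^d)=\begin{bmatrix} Y_p \\ Y_f \end{bmatrix}$ (first $T_p$ and last $T_f$ block rows), $M=\begin{bmatrix} U_p \\ Y_p \\ U_f \end{bmatrix}$, $M^\dagger$ its Moore-Penrose pseudoinverse, $\hat K=Y_fM^\dagger$, $e_i$ the $i$-th standard basis vector of $\mathbb{R}^N$. Further, $\bar{\mathbb{P}}_{y_f\mid m_f}=\frac1N\sum_{i=1}^N\delta_{Km_f+\bar\xi_f^{(i)}}$ with $\bar\xi_f^{(i)}=(Y_f-KM)e_i$. Norms, distance, CVaR. $\|\cdot\|_r$ is the $\ell_r$-norm on vectors and the induced operator norm on matrices. $d_{W_r}(Q_1,Q_2)=\big(\inf_\Pi\int\|y_1-y_2\|_r^r\,\Pi(dy_1,dy_2)\big)^{1/r}$, $\Pi$ ranging over couplings of $Q_1,Q_2$. $\mathrm{CVaR}_Q^{1-\beta}(\phi(y))=\inf_{t\in\mathbb{R}}\{\frac1\beta\mathbb{E}_Q[(\phi(y)-t)_+]+t\}$,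 $(\cdot)_+=\max\{\cdot,0\}$. *)

theory Defs
  imports
    "HOL-Probability.Probability"
    "Jordan_Normal_Form.DL_Rank"
begin

no_notation vec_nth (infixl "$" 90)
hide_const (open) Finite_Cartesian_Product.vec Finite_Cartesian_Product.mat

text \<open>
  Vectors and matrices are those of \<open>Jordan_Normal_Form\<close>, so that the sizes
  may depend on the horizons and on the amount of data. Matrix and vector indices start at 0;
  time indices of trajectories start at 1.

  The Borel sets of \<open>\<real>\<^sup>d\<close>, carried over from the finite product of Borel spaces along
  the coordinate map.
\<close>

definition borel_vec :: "nat \<Rightarrow> real vec measure" where
  "borel_vec d =
     vimage_algebra (carrier_vec d) (\<lambda>v. \<lambda>i\<in>{..<d}. v $ i) (\<Pi>\<^sub>M i\<in>{..<d}. borel)"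

definition lr_norm :: "real \<Rightarrow> real vec \<Rightarrow> real" where
  "lr_norm r v = (\<Sum>i<dim_vec v. \<bar>v $ i\<bar> powr r) powr (1 / r)"

definition op_norm :: "real \<Rightarrow> real mat \<Rightarrow> real" where
  "op_norm r X = (SUP v\<in>{v \<in> carrier_vec (dim_col X). lr_norm r v \<le> 1}. lr_norm r (X *\<^sub>v v))"

definition convex_vec :: "nat \<Rightarrow> (real vec \<Rightarrow> real) \<Rightarrow> bool" where
  "convex_vec d f \<longleftrightarrow>
     (\<forall>x\<in>carrier_vec d. \<forall>y\<in>carrier_vec d. \<forall>t\<in>{0..1}.
        f (t \<cdot>\<^sub>v x + (1 - t) \<cdot>\<^sub>v y) \<le> t * f x + (1 - t) * f y)"

definition lipschitz_vec :: "real \<Rightarrow> nat \<Rightarrow> real \<Rightarrow> (real vec \<Rightarrow> real) \<Rightarrow> bool" where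
  "lipschitz_vec r d L f \<longleftrightarrow>
     (\<forall>x\<in>carrier_vec d. \<forall>y\<in>carrier_vec d. \<bar>f x - f y\<bar> \<le> L * lr_norm r (x - y))"

definition is_moore_penrose :: "real mat \<Rightarrow> real mat \<Rightarrow> bool" where
  "is_moore_penrose X Y \<longleftrightarrow>
     Y \<in> carrier_mat (dim_col X) (dim_row X) \<and>
     X * Y * X = X \<and> Y * X * Y = Y \<and>
     transpose_mat (X * Y) = X * Y \<and> transpose_mat (Y * X) = Y * X"

definition pinv :: "real mat \<Rightarrow> real mat" where
  "pinv X = (THE Y. is_moore_penrose X Y)"

definition append_cols :: "real mat \<Rightarrow> real mat \<Rightarrow> real mat" (infixr "@\<^sub>c" 65) where
  "X @\<^sub>c Y = four_block_mat X Y (0\<^sub>m 0 (dim_col X)) (0\<^sub>m 0 (dim_col Y))"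

text \<open>The matrix of \<open>I \<times> J\<close> blocks \<open>F i j\<close>, each of size \<open>a \<times> b\<close>.\<close>

definition block_mat :: "nat \<Rightarrow> nat \<Rightarrow> nat \<Rightarrow> nat \<Rightarrow> (nat \<Rightarrow> nat \<Rightarrow> real mat) \<Rightarrow> real mat" where
  "block_mat a b I J F = Matrix.mat (a * I) (b * J) (\<lambda>(i, j). F (i div a) (j div b) $$ (i mod a, j mod b))"

text \<open>\<open>stack q z k l\<close> is \<open>z\<^bsub>[k, k+l-1]\<^esub>\<close> for a sequence \<open>z\<close> in \<open>\<real>\<^sup>q\<close>.\<close>

definition stack :: "nat \<Rightarrow> (nat \<Rightarrow> real vec) \<Rightarrow> nat \<Rightarrow> nat \<Rightarrow> real vec" where
  "stack q z k l = Matrix.vec (q * l) (\<lambda>i. z (k + i div q) $ (i mod q))"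

definition obs_mat :: "real mat \<Rightarrow> real mat \<Rightarrow> nat \<Rightarrow> real mat" where
  "obs_mat A C l = block_mat (dim_row C) (dim_row A) l 1 (\<lambda>i _. C * A ^\<^sub>m i)"

definition observable :: "real mat \<Rightarrow> real mat \<Rightarrow> bool" where
  "observable A C \<longleftrightarrow> vec_space.rank (dim_row C * dim_row A) (obs_mat A C (dim_row A)) = dim_row A"

text \<open>
  Iterating the system over \<open>l\<close> steps from the state \<open>x\<close> gives the outputs
  \<open>obs_mat A C l x + toeplitz_u A B C D l u + toeplitz_w A C l w + v\<close> and the state
  \<open>A\<^sup>l x + reach_u A B l u + reach_w A l w\<close>.
\<close>

definition toeplitz_u :: "real mat \<Rightarrow> real mat \<Rightarrow> real mat \<Rightarrow> real mat \<Rightarrow> nat \<Rightarrow> real mat" where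
  "toeplitz_u A B C D l = block_mat (dim_row C) (dim_col B) l l
     (\<lambda>i j. if j < i then C * A ^\<^sub>m (i - j - 1) * B
            else if i = j then D else 0\<^sub>m (dim_row C) (dim_col B))"

definition toeplitz_w :: "real mat \<Rightarrow> real mat \<Rightarrow> nat \<Rightarrow> real mat" where
  "toeplitz_w A C l = block_mat (dim_row C) (dim_row A) l l
     (\<lambda>i j. if j < i then C * A ^\<^sub>m (i - j - 1) else 0\<^sub>m (dim_row C) (dim_row A))"

definition reach_u :: "real mat \<Rightarrow> real mat \<Rightarrow> nat \<Rightarrow> real mat" where
  "reach_u A B l = block_mat (dim_row A) (dim_col B) 1 l (\<lambda>_ j. A ^\<^sub>m (l - j - 1) * B)"

definition reach_w :: "real mat \<Rightarrow> nat \<Rightarrow> real mat" where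
  "reach_w A l = block_mat (dim_row A) (dim_row A) 1 l (\<lambda>_ j. A ^\<^sub>m (l - j - 1))"

text \<open>In the following, \<open>Oinv\<close> is the chosen left inverse of \<open>obs_mat A C Tp\<close>.\<close>

definition predictor ::
  "real mat \<Rightarrow> real mat \<Rightarrow> real mat \<Rightarrow> real mat \<Rightarrow> nat \<Rightarrow> nat \<Rightarrow> real mat \<Rightarrow> real mat" where
  "predictor A B C D Tp Tf Oinv =
     (obs_mat A C Tf * (reach_u A B Tp - A ^\<^sub>m Tp * Oinv * toeplitz_u A B C D Tp))
     @\<^sub>c (obs_mat A C Tf * A ^\<^sub>m Tp * Oinv)
     @\<^sub>c toeplitz_u A B C D Tf"

definition disturbance ::
  "real mat \<Rightarrow> real mat \<Rightarrow> nat \<Rightarrow> nat \<Rightarrow> real mat \<Rightarrow>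
   real vec \<Rightarrow> real vec \<Rightarrow> real vec \<Rightarrow> real vec \<Rightarrow> real vec" where
  "disturbance A C Tp Tf Oinv w_p v_p w_f v_f =
     (obs_mat A C Tf * (reach_w A Tp - A ^\<^sub>m Tp * Oinv * toeplitz_w A C Tp)) *\<^sub>v w_p
     - (obs_mat A C Tf * A ^\<^sub>m Tp * Oinv) *\<^sub>v v_p
     + toeplitz_w A C Tf *\<^sub>v w_f + v_f"

text \<open>
  \<open>Pwv\<close> is the joint law of one noise pair \<open>(w\<^sub>k, v\<^sub>k)\<close>. Only independence over time is
  required: the two components may be correlated.
\<close>

definition disturbance_law ::
  "real mat \<Rightarrow> real mat \<Rightarrow> nat \<Rightarrow> nat \<Rightarrow> real mat \<Rightarrow> (real vec \<times> real vec) measure \<Rightarrow> real vec measure"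
where
  "disturbance_law A C Tp Tf Oinv Pwv =
     distr (\<Pi>\<^sub>M k\<in>{..<Tp + Tf}. Pwv) (borel_vec (dim_row C * Tf))
       (\<lambda>z. disturbance A C Tp Tf Oinv
              (stack (dim_row A) (\<lambda>k. fst (z k)) 0 Tp) (stack (dim_row C) (\<lambda>k. snd (z k)) 0 Tp)
              (stack (dim_row A) (\<lambda>k. fst (z k)) Tp Tf) (stack (dim_row C) (\<lambda>k. snd (z k)) Tp Tf))"

definition output_law :: "real mat \<Rightarrow> real vec measure \<Rightarrow> real vec \<Rightarrow> real vec measure" where
  "output_law K Pxi mf = distr Pxi (borel_vec (dim_row K)) (\<lambda>\<xi>. K *\<^sub>v mf + \<xi>)"

text \<open>Column \<open>j\<close> is \<open>z\<^bsub>[j+1, j+l]\<^esub>\<close>; there are \<open>N\<close> columns.\<close>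

definition hankel :: "nat \<Rightarrow> nat \<Rightarrow> nat \<Rightarrow> (nat \<Rightarrow> real vec) \<Rightarrow> real mat" where
  "hankel q l N z = mat_of_cols (q * l) (map (\<lambda>j. stack q z (j + 1) l) [0..<N])"

definition past_rows :: "nat \<Rightarrow> nat \<Rightarrow> nat \<Rightarrow> nat \<Rightarrow> (nat \<Rightarrow> real vec) \<Rightarrow> real mat" where
  "past_rows q Tp Tf N z = Matrix.mat (q * Tp) N (\<lambda>(i, j). hankel q (Tp + Tf) N z $$ (i, j))"

definition future_rows :: "nat \<Rightarrow> nat \<Rightarrow> nat \<Rightarrow> nat \<Rightarrow> (nat \<Rightarrow> real vec) \<Rightarrow> real mat" where
  "future_rows q Tp Tf N z =
     Matrix.mat (q * Tf) N (\<lambda>(i, j). hankel q (Tp + Tf) N z $$ (q * Tp + i, j))"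

text \<open>
  \<open>empirical_law K M Yf mf\<close> is \<open>1/N \<Sum>\<^sub>i \<delta>\<close> at the points \<open>K mf + (Yf - K M) e\<^sub>i\<close>,
  written as the image of the uniform distribution on the column indices.
\<close>

definition empirical_law :: "real mat \<Rightarrow> real mat \<Rightarrow> real mat \<Rightarrow> real vec \<Rightarrow> real vec measure" where
  "empirical_law K M Yf mf =
     distr (uniform_count_measure {..<dim_col M}) (borel_vec (dim_row K))
       (\<lambda>i. K *\<^sub>v mf + (Yf - K * M) *\<^sub>v unit_vec (dim_col M) i)"

definition ennpowr :: "ennreal \<Rightarrow> real \<Rightarrow> ennreal" where
  "ennpowr x a = (if x = \<top> then \<top> else ennreal (enn2real x powr a))"

definition couplings :: "'a measure \<Rightarrow> 'b measure \<Rightarrow> ('a \<times> 'b) measure set" where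
  "couplings Q1 Q2 =
     {R. sets R = sets (Q1 \<Otimes>\<^sub>M Q2) \<and> distr R Q1 fst = Q1 \<and> distr R Q2 snd = Q2}"

definition wasserstein :: "real \<Rightarrow> real vec measure \<Rightarrow> real vec measure \<Rightarrow> ennreal" where
  "wasserstein r Q1 Q2 =
     ennpowr (INF R\<in>couplings Q1 Q2. \<integral>\<^sup>+ z. ennreal (lr_norm r (fst z - snd z) powr r) \<partial>R) (1 / r)"

text \<open>\<open>cvar Q \<beta> \<phi>\<close> is the CVaR at level \<open>1 - \<beta>\<close>.\<close>

definition cvar :: "'a measure \<Rightarrow> real \<Rightarrow> ('a \<Rightarrow> real) \<Rightarrow> real" where
  "cvar Q \<beta> \<phi> = (INF t. (1 / \<beta>) * (\<integral>y. max (\<phi> y - t) 0 \<partial>Q) + t)"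

definition rate :: "real \<Rightarrow> real \<Rightarrow> real \<Rightarrow> nat \<Rightarrow> nat \<Rightarrow> real" where
  "rate C0 r q d N = C0 *
     (if r > real d / 2 then real N powr (- (1 / 2)) + real N powr (- ((q - r) / q))
      else if r = real d / 2
           then real N powr (- (1 / 2)) * ln (1 + real N) + real N powr (- ((q - r) / q))
      else real N powr (- (r / real d)) + real N powr (- ((q - r) / q)))"

text \<open>
  Throughout, \<open>M = Up @\<^sub>r Yp @\<^sub>r Uf\<close> is the regressor matrix, and \<open>e1\<close>, \<open>e2\<close> are the values
  \<open>\<epsilon>\<^sub>1(\<alpha>)\<close>, \<open>\<epsilon>\<^sub>2(\<alpha>)\<close>.
\<close>

definition radius :: "real \<Rightarrow> real \<Rightarrow> real \<Rightarrow> real mat \<Rightarrow> real vec \<Rightarrow> real" where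
  "radius r e1 e2 M mf =
     e1 * ((1 / real (dim_col M)) *
           (\<Sum>i<dim_col M. lr_norm r (M *\<^sub>v unit_vec (dim_col M) i - mf) powr r)) powr (1 / r)
     + e2"

definition scenario :: "real mat \<Rightarrow> real mat \<Rightarrow> real vec \<Rightarrow> nat \<Rightarrow> real vec" where
  "scenario M Yf g i =
     Yf *\<^sub>v g + (Yf * (1\<^sub>m (dim_col M) - pinv M * M)) *\<^sub>v unit_vec (dim_col M) i"

definition program_cost ::
  "(real vec \<Rightarrow> real) \<Rightarrow> (real vec \<Rightarrow> real) \<Rightarrow> real \<Rightarrow> real \<Rightarrow>
   real mat \<Rightarrow> real mat \<Rightarrow> real mat \<Rightarrow> real vec \<Rightarrow> real" where
  "program_cost f1 f2 Lobj eps M Uf Yf g =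
     f1 (Uf *\<^sub>v g) + (1 / real (dim_col M)) * (\<Sum>i<dim_col M. f2 (scenario M Yf g i)) + Lobj * eps"

definition program_feasible ::
  "(real vec \<Rightarrow> real) \<Rightarrow> real vec set \<Rightarrow> real \<Rightarrow> real \<Rightarrow> real \<Rightarrow> real vec \<Rightarrow> real vec \<Rightarrow>
   real mat \<Rightarrow> real mat \<Rightarrow> real mat \<Rightarrow> real mat \<Rightarrow> real mat \<Rightarrow>
   real vec \<Rightarrow> real \<Rightarrow> real vec \<Rightarrow> bool" where
  "program_feasible h U \<beta> Lcon eps up yp M Up Yp Uf Yf g \<tau> s \<longleftrightarrow>
     (let N = dim_col M in
      g \<in> carrier_vec N \<and> s \<in> carrier_vec N \<and>
      Up *\<^sub>v g = up \<and> Yp *\<^sub>v g = yp \<and> (1\<^sub>m N - pinv M * M) *\<^sub>v g = 0\<^sub>v N \<and> Uf *\<^sub>v g \<in> U \<and>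
      - \<tau> * \<beta> + Lcon * eps + (1 / real N) * (\<Sum>i<N. s $ i) \<le> 0 \<and>
      (\<forall>i<N. \<tau> + h (scenario M Yf g i) \<le> s $ i \<and> 0 \<le> s $ i))"

end

theory Submission
  imports Defs
begin

text \<open>
  For a feasible \<open>g\<close> the constraint \<open>(I - P) g = 0\<close> gives \<open>Yf g = Khat mf\<close>, so the \<open>i\<close>-th scenario differs from
  the atom \<open>K mf + (Yf - K M) e\<^sub>i\<close> of the empirical law by \<open>(K - Khat) (mf - M e\<^sub>i)\<close>. On the event
  \<open>\<parallel>K - Khat\<parallel> \<le> \<epsilon>\<^sub>1\<close> the power mean inequality bounds the mean displacement by the first term of \<open>\<epsilon>\<close>.
  The distance between the empirical law and the true law does not depend on \<open>mf\<close>, as both are translated by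
  \<open>K mf\<close>; hence the concentration bound at \<open>mf = 0\<close> and Markov's inequality give distance at most \<open>\<epsilon>\<^sub>2\<close>, for the
  random \<open>mf\<close> as well, up to probability \<open>\<alpha> / 2\<close>. On both events every \<open>L\<close>-Lipschitz function has expectation at
  most its scenario mean plus \<open>L \<epsilon>\<close>. This is applied to \<open>f2\<close> and to the hinge \<open>max (h + \<tau>) 0\<close>, the CVaR being
  bounded by its value at \<open>t = - \<tau>\<close>.

  Measurability of the two events in the conclusion rests on a measurable choice of the pseudoinverse and on the
  continuity of Lipschitz functions and their expectations.
\<close>

section \<open>Measurable dependence of the pseudoinverse\<close>

text \<open>\<open>measure\<close> assigns 0 to a non-measurable set, so each lower bound in the
  conclusion also contains a measurability claim. The other obstacle is that \<open>g\<close>,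
  \<open>mf\<close> and the multiplier \<open>\<tau>\<close> depend on the same data as the
  empirical law, so a concentration estimate for one fixed test function or one fixed regressor
  would not apply to them. The two good events are therefore chosen without reference to
  \<open>g\<close>, and on them the estimate holds for all Lipschitz functions and all feasible
  points at once. One event thus serves both conclusions. The argument \<open>\<alpha> / 2\<close>
  in the first radius and the factor 2 in the second are the two halves of the risk budget: one pays
  for the predictor error, the other for Markov's inequality.\<close>

definition measurable_mat :: "'a measure \<Rightarrow> nat \<Rightarrow> nat \<Rightarrow> ('a \<Rightarrow> real mat) \<Rightarrow> bool" where
  "measurable_mat S a b X \<longleftrightarrow>
     (\<forall>\<omega>. X \<omega> \<in> carrier_mat a b) \<and> (\<forall>i<a. \<forall>j<b. (\<lambda>\<omega>. X \<omega> $$ (i, j)) \<in> borel_measurable S)"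

text \<open>Matrices have a fixed size at every point, but a random vector such as \<open>g\<close>
  has a known dimension only on \<open>space S\<close>. Membership in the carrier is therefore a
  separate premise wherever it matters.\<close>

definition measurable_vec :: "'a measure \<Rightarrow> nat \<Rightarrow> ('a \<Rightarrow> real vec) \<Rightarrow> bool" where
  "measurable_vec S d X \<longleftrightarrow> (\<forall>i<d. (\<lambda>\<omega>. X \<omega> $ i) \<in> borel_measurable S)"

text \<open>The laws below have equations between dimensions as premises instead of carrier
  memberships: every size that occurs in them is determined by the terms being rewritten, so the
  simplifier can discharge them.\<close>

lemma mult_assoc_mat:
  "dim_col X = dim_row Y \<Longrightarrow> dim_col Y = dim_row Z \<Longrightarrow> (X * Y) * Z = X * (Y * (Z :: 'a :: semiring_0 mat))"
  by (rule assoc_mult_mat) auto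

lemma one_mult_mat: "dim_row X = b \<Longrightarrow> 1\<^sub>m b * X = (X :: 'a :: semiring_1 mat)"
  by (rule left_mult_one_mat) auto

lemma mult_one_mat: "dim_col X = b \<Longrightarrow> X * 1\<^sub>m b = (X :: 'a :: semiring_1 mat)"
  by (rule right_mult_one_mat) auto

lemma mult_zero_mat: "dim_col X = b \<Longrightarrow> X * 0\<^sub>m b c = (0\<^sub>m (dim_row X) c :: 'a :: semiring_0 mat)"
  by (rule right_mult_zero_mat) (rule carrier_matI; simp)

lemma zero_mult_mat: "dim_row X = b \<Longrightarrow> 0\<^sub>m c b * X = (0\<^sub>m c (dim_col X) :: 'a :: semiring_0 mat)"
  by (rule left_mult_zero_mat) (rule carrier_matI; simp)

lemma minus_mult_mat:
  "dim_row X = dim_row Y \<Longrightarrow> dim_col X = dim_col Y \<Longrightarrow> dim_col X = dim_row Z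
   \<Longrightarrow> (X - Y) * Z = X * Z - Y * (Z :: 'a :: ring mat)"
  by (rule minus_mult_distrib_mat) auto

lemma mult_minus_mat:
  "dim_row Y = dim_row Z \<Longrightarrow> dim_col Y = dim_col Z \<Longrightarrow> dim_col X = dim_row Y
   \<Longrightarrow> X * (Y - Z) = X * Y - X * (Z :: 'a :: ring mat)"
  by (rule mult_minus_distrib_mat) auto

lemma add_mult_mat:
  "dim_row X = dim_row Y \<Longrightarrow> dim_col X = dim_col Y \<Longrightarrow> dim_col X = dim_row Z
   \<Longrightarrow> (X + Y) * Z = X * Z + Y * (Z :: 'a :: semiring_0 mat)"
  by (rule add_mult_distrib_mat) auto

lemma mult_add_mat:
  "dim_row Y = dim_row Z \<Longrightarrow> dim_col Y = dim_col Z \<Longrightarrow> dim_col X = dim_row Y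
   \<Longrightarrow> X * (Y + Z) = X * Y + X * (Z :: 'a :: semiring_0 mat)"
  by (rule mult_add_distrib_mat) auto

lemma transpose_mult_mat:
  "dim_col X = dim_row Y \<Longrightarrow> transpose_mat (X * Y) = transpose_mat Y * transpose_mat (X :: 'a :: comm_semiring_0 mat)"
  by (rule transpose_mult) auto

lemma transpose_minus_mat:
  "dim_row X = dim_row Y \<Longrightarrow> dim_col X = dim_col Y
   \<Longrightarrow> transpose_mat (X - Y) = transpose_mat X - transpose_mat (Y :: 'a :: minus mat)"
  by (intro eq_matI) auto

section \<open>Entrywise measurability of matrix operations\<close>

lemma measurable_matI:
  assumes "\<And>\<omega>. dim_row (X \<omega>) = a" "\<And>\<omega>. dim_col (X \<omega>) = b"
    and "\<And>i j. i < a \<Longrightarrow> j < b \<Longrightarrow> (\<lambda>\<omega>. X \<omega> $$ (i, j)) \<in> borel_measurable S"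
  shows "measurable_mat S a b X"
  using assms unfolding measurable_mat_def by (intro conjI allI impI carrier_matI)

lemma measurable_mat_dims: "measurable_mat S a b X \<Longrightarrow> dim_row (X \<omega>) = a \<and> dim_col (X \<omega>) = b"
  by (auto simp: measurable_mat_def)

lemma measurable_mat_index:
  "measurable_mat S a b X \<Longrightarrow> i < a \<Longrightarrow> j < b \<Longrightarrow> (\<lambda>\<omega>. X \<omega> $$ (i, j)) \<in> borel_measurable S"
  by (auto simp: measurable_mat_def)

lemma measurable_mat_const: "X \<in> carrier_mat a b \<Longrightarrow> measurable_mat S a b (\<lambda>_. X)"
  by (auto simp: measurable_mat_def)

lemma measurable_mat_diff:
  assumes X: "measurable_mat S a b X" and Y: "measurable_mat S a b Y"
  shows "measurable_mat S a b (\<lambda>\<omega>. X \<omega> - Y \<omega>)"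
proof (rule measurable_matI)
  fix i j assume ij: "i < a" "j < b"
  have "(\<lambda>\<omega>. X \<omega> $$ (i, j) - Y \<omega> $$ (i, j)) \<in> borel_measurable S"
    using measurable_mat_index[OF X ij] measurable_mat_index[OF Y ij] by (rule borel_measurable_diff)
  then show "(\<lambda>\<omega>. (X \<omega> - Y \<omega>) $$ (i, j)) \<in> borel_measurable S"
    using ij by (simp add: measurable_mat_dims[OF Y])
qed (use measurable_mat_dims[OF Y] in auto)

lemma measurable_mat_add:
  assumes X: "measurable_mat S a b X" and Y: "measurable_mat S a b Y"
  shows "measurable_mat S a b (\<lambda>\<omega>. X \<omega> + Y \<omega>)"
proof (rule measurable_matI)
  fix i j assume ij: "i < a" "j < b"
  have "(\<lambda>\<omega>. X \<omega> $$ (i, j) + Y \<omega> $$ (i, j)) \<in> borel_measurable S"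
    using measurable_mat_index[OF X ij] measurable_mat_index[OF Y ij] by (rule borel_measurable_add)
  then show "(\<lambda>\<omega>. (X \<omega> + Y \<omega>) $$ (i, j)) \<in> borel_measurable S"
    using ij by (simp add: measurable_mat_dims[OF Y])
qed (use measurable_mat_dims[OF Y] in auto)

lemma measurable_mat_transpose:
  assumes X: "measurable_mat S a b X"
  shows "measurable_mat S b a (\<lambda>\<omega>. transpose_mat (X \<omega>))"
proof (rule measurable_matI)
  fix i j assume "i < b" "j < a"
  then show "(\<lambda>\<omega>. transpose_mat (X \<omega>) $$ (i, j)) \<in> borel_measurable S"
    using measurable_mat_index[OF X] by (simp add: measurable_mat_dims[OF X])
qed (simp_all add: measurable_mat_dims[OF X])

lemma measurable_mat_mult:
  assumes X: "measurable_mat S a b X" and Y: "measurable_mat S b c Y"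
  shows "measurable_mat S a c (\<lambda>\<omega>. X \<omega> * Y \<omega>)"
proof (rule measurable_matI)
  fix i j assume ij: "i < a" "j < c"
  have "(\<lambda>\<omega>. \<Sum>k\<in>{0..<b}. X \<omega> $$ (i, k) * Y \<omega> $$ (k, j)) \<in> borel_measurable S"
    using ij by (intro borel_measurable_sum borel_measurable_times measurable_mat_index[OF X] measurable_mat_index[OF Y]) auto
  then show "(\<lambda>\<omega>. (X \<omega> * Y \<omega>) $$ (i, j)) \<in> borel_measurable S"
    using ij by (simp add: measurable_mat_dims[OF X] measurable_mat_dims[OF Y] scalar_prod_def)
qed (simp_all add: measurable_mat_dims[OF X] measurable_mat_dims[OF Y])

lemma measurable_mult_mat_vec:
  assumes "measurable_mat S a b X" "measurable_vec S b z" "\<And>\<omega>. \<omega> \<in> space S \<Longrightarrow> z \<omega> \<in> carrier_vec b"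
  shows "measurable_vec S a (\<lambda>\<omega>. X \<omega> *\<^sub>v z \<omega>)"
  unfolding measurable_vec_def
proof (intro allI impI)
  fix i assume i: "i < a"
  have "(\<lambda>\<omega>. \<Sum>j<b. X \<omega> $$ (i, j) * z \<omega> $ j) \<in> borel_measurable S"
    using assms(2) i unfolding measurable_vec_def
    by (intro borel_measurable_sum borel_measurable_times measurable_mat_index[OF assms(1)]) auto
  moreover have "(X \<omega> *\<^sub>v z \<omega>) $ i = (\<Sum>j<b. X \<omega> $$ (i, j) * z \<omega> $ j)" if "\<omega> \<in> space S" for \<omega>
    using measurable_mat_dims[OF assms(1), of \<omega>] assms(3)[OF that] i
    by (auto simp: scalar_prod_def atLeast0LessThan intro!: sum.cong)
  ultimately show "(\<lambda>\<omega>. (X \<omega> *\<^sub>v z \<omega>) $ i) \<in> borel_measurable S"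
    by (subst measurable_cong) auto
qed

text \<open>
  Wedderburn's rank reduction: \<open>X - X E X\<close> has one more zero row than \<open>X\<close> when \<open>E\<close> has the single
  entry \<open>1 / X\<^bsub>k j\<^esub>\<close> at \<open>(j, k)\<close>, and \<open>(I - E X) Z' (I - X E) + E\<close> is an inner inverse of \<open>X\<close>
  whenever \<open>Z'\<close> is one of \<open>X - X E X\<close>. Every choice is a measurable function of the entries.
\<close>

lemma measurable_inner_inverse_rows:
  assumes "measurable_mat S a b X" "k \<le> a"
    and "\<And>\<omega> i j. k \<le> i \<Longrightarrow> i < a \<Longrightarrow> j < b \<Longrightarrow> X \<omega> $$ (i, j) = 0"
  shows "\<exists>Z. measurable_mat S b a Z \<and> (\<forall>\<omega>. X \<omega> * Z \<omega> * X \<omega> = X \<omega>)"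
  using assms
proof (induction k arbitrary: X)
  case 0
  have "X \<omega> = 0\<^sub>m a b" for \<omega>
    using 0(3) measurable_mat_dims[OF 0(1), of \<omega>] by (intro eq_matI) auto
  then show ?case
    by (intro exI[of _ "\<lambda>_. 0\<^sub>m b a"] conjI measurable_mat_const) auto
next
  case (Suc k)
  have k: "k < a" using Suc(3) by simp
  \<comment> \<open>The pivot of row \<open>k\<close> is its first nonzero entry. Being first is a
    finite condition on the entries, which makes this choice measurable. A zero row gives
    \<open>E = 0\<close>, and then \<open>X' = X\<close>.\<close>
  define E where "E = (\<lambda>\<omega>. Matrix.mat b a (\<lambda>(j, i).
    if i = k \<and> X \<omega> $$ (k, j) \<noteq> 0 \<and> (\<forall>j'<j. X \<omega> $$ (k, j') = 0) then 1 / X \<omega> $$ (k, j) else 0))"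
  have E: "measurable_mat S b a E"
    unfolding measurable_mat_def
  proof (intro conjI allI impI)
    fix i j assume ij: "i < b" "j < a"
    have "Measurable.pred S (\<lambda>\<omega>. X \<omega> $$ (k, j') = 0)" if "j' \<in> {..<i}" for j'
    proof -
      have [measurable]: "(\<lambda>\<omega>. X \<omega> $$ (k, j')) \<in> borel_measurable S"
        using that ij k by (intro measurable_mat_index[OF Suc(2)]) auto
      show ?thesis by measurable
    qed
    then have [measurable]: "Measurable.pred S (\<lambda>\<omega>. \<forall>j'\<in>{..<i}. X \<omega> $$ (k, j') = 0)"
      by (intro pred_intros_finite) auto
    have [measurable]: "(\<lambda>\<omega>. X \<omega> $$ (k, i)) \<in> borel_measurable S"
      using k ij by (intro measurable_mat_index[OF Suc(2)]) auto
    have "(\<lambda>\<omega>. if X \<omega> $$ (k, i) \<noteq> 0 \<and> (\<forall>j'\<in>{..<i}. X \<omega> $$ (k, j') = 0) then 1 / X \<omega> $$ (k, i) else 0)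
        \<in> borel_measurable S"
      by measurable
    moreover have "(\<lambda>\<omega>. E \<omega> $$ (i, j)) = (\<lambda>\<omega>. if j = k then
        if X \<omega> $$ (k, i) \<noteq> 0 \<and> (\<forall>j'\<in>{..<i}. X \<omega> $$ (k, j') = 0) then 1 / X \<omega> $$ (k, i) else 0 else 0)"
      using ij by (auto simp: E_def fun_eq_iff)
    ultimately show "(\<lambda>\<omega>. E \<omega> $$ (i, j)) \<in> borel_measurable S"
      by (cases "j = k") simp_all
  qed (simp add: E_def)
  define X' where "X' = (\<lambda>\<omega>. X \<omega> - X \<omega> * (E \<omega> * X \<omega>))"
  have dX: "dim_row (X \<omega>) = a" "dim_col (X \<omega>) = b" for \<omega>
    using measurable_mat_dims[OF Suc(2)] by auto
  have dE: "dim_row (E \<omega>) = b" "dim_col (E \<omega>) = a" for \<omega>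
    by (simp_all add: E_def)
  have X': "measurable_mat S a b X'"
    unfolding X'_def
    by (rule measurable_mat_diff[OF Suc(2) measurable_mat_mult[OF Suc(2) measurable_mat_mult[OF E Suc(2)]]])
  \<comment> \<open>Rows after \<open>k\<close> vanish in \<open>X\<close>, hence also in
    \<open>X E X\<close>. Row \<open>k\<close>, if it has a pivot, is cancelled because
    \<open>X E\<close> has entry 1 at \<open>(k, k)\<close>.\<close>
  have row_X': "X' \<omega> $$ (i, l) = 0" if il: "k \<le> i" "i < a" "l < b" for \<omega> i l
  proof -
    have EX: "(E \<omega> * X \<omega>) $$ (j, l) = E \<omega> $$ (j, k) * X \<omega> $$ (k, l)" if j: "j < b" for j
    proof -
      have "(E \<omega> * X \<omega>) $$ (j, l) = (\<Sum>i\<in>{0..<a}. E \<omega> $$ (j, i) * X \<omega> $$ (i, l))"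
        using j il dX dE by (simp add: scalar_prod_def)
      also have "\<dots> = (\<Sum>i\<in>{k}. E \<omega> $$ (j, i) * X \<omega> $$ (i, l))"
        using k j by (intro sum.mono_neutral_right) (auto simp: E_def)
      finally show ?thesis by simp
    qed
    have XEX: "(X \<omega> * (E \<omega> * X \<omega>)) $$ (i, l) = (\<Sum>j\<in>{0..<b}. X \<omega> $$ (i, j) * E \<omega> $$ (j, k)) * X \<omega> $$ (k, l)"
    proof -
      have "(X \<omega> * (E \<omega> * X \<omega>)) $$ (i, l) = (\<Sum>j\<in>{0..<b}. X \<omega> $$ (i, j) * (E \<omega> * X \<omega>) $$ (j, l))"
        using il dX dE by (simp add: scalar_prod_def)
      also have "\<dots> = (\<Sum>j\<in>{0..<b}. X \<omega> $$ (i, j) * (E \<omega> $$ (j, k) * X \<omega> $$ (k, l)))"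
        by (intro sum.cong) (auto simp: EX)
      finally show ?thesis by (simp add: sum_distrib_right mult.assoc)
    qed
    show ?thesis
    proof (cases "i = k")
      case False
      then have "X \<omega> $$ (i, j) = 0" if "j < b" for j
        using Suc(4)[of i j \<omega>] il that by simp
      then show ?thesis using XEX il dX dE by (simp add: X'_def)
    next
      case True
      show ?thesis
      proof (cases "\<exists>j<b. X \<omega> $$ (k, j) \<noteq> 0")
        case False
        then show ?thesis using XEX il dX dE True by (simp add: X'_def)
      next
        case ex: True
        define j0 where "j0 = (LEAST j. j < b \<and> X \<omega> $$ (k, j) \<noteq> 0)"
        have j0: "j0 < b" "X \<omega> $$ (k, j0) \<noteq> 0"
          using LeastI_ex[OF ex] by (auto simp: j0_def)
        have min: "X \<omega> $$ (k, j) = 0" if "j < j0" for j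
          using not_less_Least[of j "\<lambda>j. j < b \<and> X \<omega> $$ (k, j) \<noteq> 0"] that j0 by (auto simp: j0_def)
        \<comment> \<open>Left of the pivot the row of \<open>X\<close> vanishes; right of it
          \<open>E\<close> does, since an earlier nonzero entry exists.\<close>
        have "(\<Sum>j\<in>{0..<b}. X \<omega> $$ (k, j) * E \<omega> $$ (j, k)) = (\<Sum>j\<in>{j0}. X \<omega> $$ (k, j) * E \<omega> $$ (j, k))"
        proof (intro sum.mono_neutral_right ballI)
          fix j assume "j \<in> {0..<b} - {j0}"
          then have "j < b" "j < j0 \<or> j0 < j" by auto
          then show "X \<omega> $$ (k, j) * E \<omega> $$ (j, k) = 0"
            using j0(2) k min[of j] by (auto simp: E_def)
        qed (use j0 in auto)
        also have "\<dots> = 1" using j0 k min by (simp add: E_def)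
        finally show ?thesis using XEX il dX dE True by (simp add: X'_def)
      qed
    qed
  qed
  obtain Z' where Z': "measurable_mat S b a Z'" "\<And>\<omega>. X' \<omega> * Z' \<omega> * X' \<omega> = X' \<omega>"
    using Suc.IH[OF X'] k row_X' by auto
  have dZ: "dim_row (Z' \<omega>) = b" "dim_col (Z' \<omega>) = a" for \<omega>
    using measurable_mat_dims[OF Z'(1)] by auto
  define Z where "Z = (\<lambda>\<omega>. (1\<^sub>m b - E \<omega> * X \<omega>) * Z' \<omega> * (1\<^sub>m a - X \<omega> * E \<omega>) + E \<omega>)"
  have EX: "measurable_mat S b b (\<lambda>\<omega>. 1\<^sub>m b - E \<omega> * X \<omega>)"
    by (rule measurable_mat_diff[OF _ measurable_mat_mult[OF E Suc(2)]]) (rule measurable_mat_const, simp)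
  have XE: "measurable_mat S a a (\<lambda>\<omega>. 1\<^sub>m a - X \<omega> * E \<omega>)"
    by (rule measurable_mat_diff[OF _ measurable_mat_mult[OF Suc(2) E]]) (rule measurable_mat_const, simp)
  have "measurable_mat S b a (\<lambda>\<omega>. (1\<^sub>m b - E \<omega> * X \<omega>) * Z' \<omega> * (1\<^sub>m a - X \<omega> * E \<omega>))"
    by (rule measurable_mat_mult[OF measurable_mat_mult[OF EX Z'(1)] XE])
  then have "measurable_mat S b a Z"
    unfolding Z_def by (rule measurable_mat_add[OF _ E])
  moreover have "X \<omega> * Z \<omega> * X \<omega> = X \<omega>" for \<omega>
  proof -
    \<comment> \<open>With both outer products equal to \<open>X'\<close>, the claim becomes
      \<open>X' Z' X' + X E X = X' + X E X = X\<close>.\<close>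
    have 1: "X \<omega> * (1\<^sub>m b - E \<omega> * X \<omega>) = X' \<omega>" "(1\<^sub>m a - X \<omega> * E \<omega>) * X \<omega> = X' \<omega>"
      using dX[of \<omega>] dE[of \<omega>] by (simp_all add: X'_def mult_minus_mat minus_mult_mat mult_assoc_mat one_mult_mat mult_one_mat)
    have "X \<omega> * Z \<omega> * X \<omega> = (X \<omega> * (1\<^sub>m b - E \<omega> * X \<omega>)) * Z' \<omega> * ((1\<^sub>m a - X \<omega> * E \<omega>) * X \<omega>) + X \<omega> * (E \<omega> * X \<omega>)"
      using dX[of \<omega>] dE[of \<omega>] dZ[of \<omega>] unfolding Z_def
      by (simp add: mult_add_mat add_mult_mat mult_assoc_mat)
    also have "\<dots> = X' \<omega> + X \<omega> * (E \<omega> * X \<omega>)" by (simp only: 1 Z'(2))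
    also have "\<dots> = X \<omega>"
      unfolding X'_def using dX[of \<omega>] dE[of \<omega>] by (intro eq_matI) auto
    finally show ?thesis .
  qed
  ultimately show ?case by blast
qed

lemma measurable_inner_inverse:
  assumes "measurable_mat S a b X"
  shows "\<exists>Z. measurable_mat S b a Z \<and> (\<forall>\<omega>. X \<omega> * Z \<omega> * X \<omega> = X \<omega>)"
  using assms by (rule measurable_inner_inverse_rows[OF _ order_refl]) auto

text \<open>The diagonal entries of the Gram matrix are the squared lengths of the columns. This
  definiteness is what turns identities for Gram matrices into identities for \<open>X\<close>
  itself.\<close>

lemma transpose_mult_self_eq_0:
  fixes X :: "real mat"
  assumes "X \<in> carrier_mat a b" "transpose_mat X * X = 0\<^sub>m b b"
  shows "X = 0\<^sub>m a b"
proof (intro eq_matI)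
  fix i j assume ij: "i < dim_row (0\<^sub>m a b :: real mat)" "j < dim_col (0\<^sub>m a b :: real mat)"
  have "(\<Sum>k\<in>{0..<a}. X $$ (k, j) * X $$ (k, j)) = (transpose_mat X * X) $$ (j, j)"
    using assms(1) ij by (auto simp: scalar_prod_def)
  also have "\<dots> = 0" using assms(2) ij by simp
  finally have "\<forall>k\<in>{0..<a}. X $$ (k, j) * X $$ (k, j) = 0"
    by (subst (asm) sum_nonneg_eq_0_iff) auto
  then show "X $$ (i, j) = 0\<^sub>m a b $$ (i, j)" using ij by simp
qed (use assms in auto)

lemma minus_eq_0_mat:
  fixes X Y :: "real mat"
  assumes "dim_row X = a" "dim_col X = b" "dim_row Y = a" "dim_col Y = b" "X - Y = 0\<^sub>m a b"
  shows "X = Y"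
proof (intro eq_matI)
  fix i j assume ij: "i < dim_row Y" "j < dim_col Y"
  then have "(X - Y) $$ (i, j) = 0" using assms by simp
  then show "X $$ (i, j) = Y $$ (i, j)" using ij by simp
qed (use assms in auto)

text \<open>Cancellation of \<open>transpose_mat X\<close> on the left: the defect \<open>D\<close>
  has \<open>X\<close> as a left factor and is annihilated by \<open>transpose_mat X\<close>, so
  \<open>transpose_mat D * D = 0\<close>.\<close>

lemma mult_gram_inner_inverse:
  fixes X Z :: "real mat"
  assumes X: "dim_row X = a" "dim_col X = b" and Z: "dim_row Z = b" "dim_col Z = b"
    and inv: "transpose_mat X * X * Z * (transpose_mat X * X) = transpose_mat X * X"
  shows "X * (Z * (transpose_mat X * X)) = X"
proof -
  define D where "D = X * (Z * (transpose_mat X * X)) - X"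
  have D: "D = X * (Z * (transpose_mat X * X) - 1\<^sub>m b)"
    unfolding D_def using X Z by (simp add: mult_minus_mat mult_one_mat)
  have "transpose_mat X * D = transpose_mat X * X * Z * (transpose_mat X * X) - transpose_mat X * X"
    unfolding D_def using X Z by (simp add: mult_minus_mat mult_assoc_mat)
  also have "\<dots> = 0\<^sub>m b b" unfolding inv using X by (intro eq_matI) auto
  finally have XD: "transpose_mat X * D = 0\<^sub>m b b" .
  have "transpose_mat D * D = transpose_mat (Z * (transpose_mat X * X) - 1\<^sub>m b) * (transpose_mat X * D)"
    using X Z by (subst D) (simp add: transpose_mult_mat mult_assoc_mat D_def)
  also have "\<dots> = 0\<^sub>m b b" unfolding XD using X Z by (simp add: mult_zero_mat)
  finally have "D = 0\<^sub>m a b"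
    using X Z by (intro transpose_mult_self_eq_0[of D, OF carrier_matI]) (simp_all add: D_def)
  then show ?thesis
    using minus_eq_0_mat[of "X * (Z * (transpose_mat X * X))" a b X] X Z by (simp add: D_def)
qed

text \<open>The witness is \<open>Z * transpose_mat X\<close> with \<open>Z\<close> an inner inverse
  of the Gram matrix. \<open>Z\<close> may fail to be symmetric, but its transpose is an inner
  inverse of the Gram matrix too. The difference \<open>D\<close> of the two resulting products is
  therefore annihilated by \<open>X\<close> on the right, and since \<open>transpose_mat D\<close>
  has \<open>X\<close> as a left factor, \<open>D * transpose_mat D = 0\<close>.\<close>

lemma measurable_symmetric_inner_inverse:
  assumes X: "measurable_mat S a b X"
  shows "\<exists>G. measurable_mat S b a G \<and> (\<forall>\<omega>. X \<omega> * G \<omega> * X \<omega> = X \<omega> \<and> transpose_mat (X \<omega> * G \<omega>) = X \<omega> * G \<omega>)"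
proof -
  obtain Z where Z: "measurable_mat S b b Z"
      "\<And>\<omega>. transpose_mat (X \<omega>) * X \<omega> * Z \<omega> * (transpose_mat (X \<omega>) * X \<omega>) = transpose_mat (X \<omega>) * X \<omega>"
    using measurable_inner_inverse[OF measurable_mat_mult[OF measurable_mat_transpose[OF X] X]] by auto
  have "X \<omega> * (Z \<omega> * transpose_mat (X \<omega>)) * X \<omega> = X \<omega> \<and>
      transpose_mat (X \<omega> * (Z \<omega> * transpose_mat (X \<omega>))) = X \<omega> * (Z \<omega> * transpose_mat (X \<omega>))" for \<omega>
  proof -
    define Y W where "Y = X \<omega>" and "W = Z \<omega>"
    have d: "dim_row Y = a" "dim_col Y = b" "dim_row W = b" "dim_col W = b"
      using measurable_mat_dims[OF X] measurable_mat_dims[OF Z(1)] by (auto simp: Y_def W_def)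
    have inv: "transpose_mat Y * Y * W * (transpose_mat Y * Y) = transpose_mat Y * Y"
      using Z(2)[of \<omega>] by (simp add: Y_def W_def)
    have inv': "transpose_mat Y * Y * transpose_mat W * (transpose_mat Y * Y) = transpose_mat Y * Y"
      using arg_cong[OF inv, of transpose_mat] d by (simp add: transpose_mult_mat mult_assoc_mat)
    have 1: "Y * (W * (transpose_mat Y * Y)) = Y"
      using d inv by (intro mult_gram_inner_inverse) auto
    have 2: "Y * (transpose_mat W * (transpose_mat Y * Y)) = Y"
      using d inv' by (intro mult_gram_inner_inverse) auto
    define D where "D = Y * (W * transpose_mat Y) - Y * (transpose_mat W * transpose_mat Y)"
    have "D * Y = Y - Y"
      unfolding D_def using d 1 2 by (simp add: minus_mult_mat mult_assoc_mat)
    then have DY: "D * Y = 0\<^sub>m a b" using d by (intro eq_matI) auto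
    have tD: "transpose_mat D = Y * ((transpose_mat W - W) * transpose_mat Y)"
      unfolding D_def using d
      by (simp add: transpose_minus_mat transpose_mult_mat mult_assoc_mat minus_mult_mat mult_minus_mat)
    have "D * transpose_mat D = (D * Y) * ((transpose_mat W - W) * transpose_mat Y)"
      unfolding tD using d by (simp add: mult_assoc_mat D_def)
    also have "\<dots> = 0\<^sub>m a a" unfolding DY using d by (simp add: zero_mult_mat)
    finally have "transpose_mat D = 0\<^sub>m a a"
      using d by (intro transpose_mult_self_eq_0[of "transpose_mat D", OF carrier_matI]) (simp_all add: D_def)
    then have "D = 0\<^sub>m a a" by (metis transpose_transpose zero_transpose_mat)
    then have "Y * (W * transpose_mat Y) = Y * (transpose_mat W * transpose_mat Y)"
      using minus_eq_0_mat[of "Y * (W * transpose_mat Y)" a a "Y * (transpose_mat W * transpose_mat Y)"] d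
      by (simp add: D_def)
    then show ?thesis unfolding Y_def[symmetric] W_def[symmetric]
      using d 1 2 by (simp add: transpose_mult_mat mult_assoc_mat)
  qed
  then show ?thesis
    by (intro exI[of _ "\<lambda>\<omega>. Z \<omega> * transpose_mat (X \<omega>)"])
      (blast intro: measurable_mat_mult[OF Z(1) measurable_mat_transpose[OF X]])
qed

text \<open>Urquhart's formula: \<open>V X W\<close> is the Moore-Penrose inverse of
  \<open>X\<close> when \<open>V\<close> and \<open>W\<close> are inner inverses with
  \<open>V X\<close> and \<open>X W\<close> symmetric, because \<open>X (V X W) = X W\<close> and
  \<open>(V X W) X = V X\<close>. The symmetric inner inverse of \<open>X\<close> gives
  \<open>W\<close>; that of the transpose, transposed, gives \<open>V\<close>.\<close>

lemma measurable_moore_penrose: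
  assumes X: "measurable_mat S a b X"
  shows "\<exists>Y. measurable_mat S b a Y \<and> (\<forall>\<omega>. is_moore_penrose (X \<omega>) (Y \<omega>))"
proof -
  obtain G where G: "measurable_mat S b a G"
    "\<And>\<omega>. X \<omega> * G \<omega> * X \<omega> = X \<omega>" "\<And>\<omega>. transpose_mat (X \<omega> * G \<omega>) = X \<omega> * G \<omega>"
    using measurable_symmetric_inner_inverse[OF X] by auto
  obtain H where H: "measurable_mat S a b H"
    "\<And>\<omega>. transpose_mat (X \<omega>) * H \<omega> * transpose_mat (X \<omega>) = transpose_mat (X \<omega>)"
    "\<And>\<omega>. transpose_mat (transpose_mat (X \<omega>) * H \<omega>) = transpose_mat (X \<omega>) * H \<omega>"
    using measurable_symmetric_inner_inverse[OF measurable_mat_transpose[OF X]] by auto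
  have "is_moore_penrose (X \<omega>) (transpose_mat (H \<omega>) * X \<omega> * G \<omega>)" for \<omega>
  proof -
    define Y V W where "Y = X \<omega>" and "V = transpose_mat (H \<omega>)" and "W = G \<omega>"
    have d: "dim_row Y = a" "dim_col Y = b" "dim_row V = b" "dim_col V = a" "dim_row W = b" "dim_col W = a"
      using measurable_mat_dims[OF X] measurable_mat_dims[OF G(1)] measurable_mat_dims[OF H(1)]
      by (auto simp: Y_def W_def V_def)
    have tV: "transpose_mat V = H \<omega>" by (simp add: V_def)
    have W: "Y * (W * Y) = Y" "transpose_mat (Y * W) = Y * W"
      using G(2)[of \<omega>] G(3)[of \<omega>] d by (simp_all add: Y_def W_def mult_assoc_mat)
    have V: "Y * (V * Y) = Y"
    proof -
      have "transpose_mat (transpose_mat Y * H \<omega> * transpose_mat Y) = Y"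
        using arg_cong[OF H(2)[of \<omega>], of transpose_mat] by (simp add: Y_def)
      then show ?thesis
        unfolding tV[symmetric] using d by (simp add: transpose_mult_mat)
    qed
    have V': "transpose_mat (V * Y) = V * Y"
    proof -
      have "transpose_mat (V * Y) = transpose_mat Y * H \<omega>"
        unfolding tV[symmetric] using d by (simp add: transpose_mult_mat)
      also have "\<dots> = transpose_mat (transpose_mat Y * H \<omega>)" using H(3)[of \<omega>] by (simp add: Y_def)
      also have "\<dots> = V * Y"
        unfolding tV[symmetric] using d by (simp add: transpose_mult_mat)
      finally show ?thesis .
    qed
    have e: "Y * (V * (Y * W)) = Y * W" "Y * (W * (Y * W)) = Y * W"
      using arg_cong[OF V, of "\<lambda>Q. Q * W"] arg_cong[OF W(1), of "\<lambda>Q. Q * W"] d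
      by (simp_all add: mult_assoc_mat)
    show ?thesis
      unfolding Y_def[symmetric] V_def[symmetric] W_def[symmetric] is_moore_penrose_def
    proof (intro conjI)
      have YX: "Y * (V * Y * W) = Y * W" using d e(1) by (simp add: mult_assoc_mat)
      have XY: "V * Y * W * Y = V * Y" using d W(1) by (simp add: mult_assoc_mat)
      show "V * Y * W \<in> carrier_mat (dim_col Y) (dim_row Y)" using d by (intro carrier_matI) auto
      show "Y * (V * Y * W) * Y = Y" using d W(1) V by (simp add: YX mult_assoc_mat)
      show "V * Y * W * Y * (V * Y * W) = V * Y * W"
        unfolding XY using d e(1) by (simp add: mult_assoc_mat)
      show "transpose_mat (Y * (V * Y * W)) = Y * (V * Y * W)" unfolding YX by (rule W(2))
      show "transpose_mat (V * Y * W * Y) = V * Y * W * Y" unfolding XY by (rule V')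
    qed
  qed
  then show ?thesis
    by (intro exI[of _ "\<lambda>\<omega>. transpose_mat (H \<omega>) * X \<omega> * G \<omega>"])
      (blast intro: measurable_mat_mult[OF measurable_mat_mult[OF measurable_mat_transpose[OF H(1)] X] G(1)])
qed

text \<open>\<open>X * Y\<close> and \<open>X * Z\<close> are both the orthogonal projection onto
  the column space of \<open>X\<close>: each absorbs the other on one side, and transposing swaps
  the sides. The same holds for \<open>Y * X\<close> and \<open>Z * X\<close>, and then
  \<open>Y = Y X Y = Z X Z = Z\<close>.\<close>

lemma moore_penrose_unique:
  assumes Y: "is_moore_penrose X Y" and Z: "is_moore_penrose X Z"
  shows "Y = Z"
proof -
  have d: "dim_row Y = dim_col X" "dim_col Y = dim_row X" "dim_row Z = dim_col X" "dim_col Z = dim_row X"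
    using assms by (auto simp: is_moore_penrose_def)
  have y: "X * Y * X = X" "Y * X * Y = Y" "transpose_mat (X * Y) = X * Y" "transpose_mat (Y * X) = Y * X"
    and z: "X * Z * X = X" "Z * X * Z = Z" "transpose_mat (X * Z) = X * Z" "transpose_mat (Z * X) = Z * X"
    using assms by (auto simp: is_moore_penrose_def)
  have "X * Y = (X * Z) * (X * Y)" using z(1) d by (metis mult_assoc_mat index_mult_mat(2,3))
  also have "\<dots> = transpose_mat ((X * Y) * (X * Z))"
    using d by (subst transpose_mult_mat) (auto simp: y(3) z(3))
  also have "(X * Y) * (X * Z) = X * Z" using y(1) d by (metis mult_assoc_mat index_mult_mat(2,3))
  finally have 1: "X * Y = X * Z" by (simp add: z(3))
  have "Y * X = (Y * X) * (Z * X)" using z(1) d by (metis mult_assoc_mat index_mult_mat(2,3))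
  also have "\<dots> = transpose_mat ((Z * X) * (Y * X))"
    using d by (subst transpose_mult_mat) (auto simp: y(4) z(4))
  also have "(Z * X) * (Y * X) = Z * X" using y(1) d by (metis mult_assoc_mat index_mult_mat(2,3))
  finally have 2: "Y * X = Z * X" by (simp add: z(4))
  have "Y = Z * X * Y" using y(2) 2 by simp
  also have "\<dots> = Z * (X * Z)" using d by (simp add: mult_assoc_mat 1)
  also have "\<dots> = Z" using z(2) d by (simp add: mult_assoc_mat)
  finally show ?thesis .
qed

text \<open>Existence is the measurable construction applied to a constant family.\<close>

lemma pinv_moore_penrose: "is_moore_penrose X (pinv X)"
proof -
  obtain Y where "is_moore_penrose X Y"
    using measurable_moore_penrose[OF measurable_mat_const[of X "dim_row X" "dim_col X"], of borel] by auto
  then show ?thesis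
    unfolding pinv_def by (rule theI) (rule moore_penrose_unique[OF _ \<open>is_moore_penrose X Y\<close>])
qed

text \<open>By uniqueness the measurable choice agrees with \<open>pinv\<close> at every point; the
  definite description defining \<open>pinv\<close> says nothing about measurability by
  itself.\<close>

lemma measurable_pinv:
  assumes "measurable_mat S a b X"
  shows "measurable_mat S b a (\<lambda>\<omega>. pinv (X \<omega>))"
proof -
  obtain Y where Y: "measurable_mat S b a Y" "\<And>\<omega>. is_moore_penrose (X \<omega>) (Y \<omega>)"
    using measurable_moore_penrose[OF assms] by auto
  then have "(\<lambda>\<omega>. pinv (X \<omega>)) = Y"
    using moore_penrose_unique[OF pinv_moore_penrose] by blast
  then show ?thesis using Y by simp
qed

section \<open>The vector and operator norms\<close>

text \<open>The three convexity inequalities that follow (two points, power mean, Jensen) all come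
  from this tangent, drawn at the respective mean, where the linear terms cancel. Since
  \<open>c\<close> must be positive, each of them treats a vanishing mean separately. Convexity is
  used on the open half-line, so \<open>x = 0\<close> is checked by hand.\<close>

lemma powr_tangent_le:
  fixes r c x :: real
  assumes r: "1 \<le> r" and c: "0 < c" and x: "0 \<le> x"
  shows "c powr r + r * c powr (r - 1) * (x - c) \<le> x powr r"
proof (cases "x = 0")
  case True
  have "c powr (r - 1) * c = c powr r"
    using c by (simp add: powr_diff)
  then have "c powr r + r * c powr (r - 1) * (0 - c) = (1 - r) * c powr r"
    by (simp add: algebra_simps)
  also have "\<dots> \<le> 0" using r by (intro mult_nonpos_nonneg) auto
  finally show ?thesis using True by simp
next
  case False
  have "x powr r - c powr r \<ge> r * c powr (r - 1) * (x - c)"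
    using x False c r
    by (intro convex_on_imp_above_tangent[where A = "{0<..}"] powr_convex)
      (auto simp: interior_open intro!: derivative_eq_intros)
  then show ?thesis by simp
qed

lemma powr_convex_comb_le:
  fixes r a b u :: real
  assumes r: "1 \<le> r" and "0 \<le> a" "0 \<le> b" "0 \<le> u" "u \<le> 1"
  shows "(u * a + (1 - u) * b) powr r \<le> u * a powr r + (1 - u) * b powr r"
proof -
  define c where "c = u * a + (1 - u) * b"
  have "0 \<le> c" using assms by (auto simp: c_def)
  show ?thesis
  proof (cases "c = 0")
    case True
    then show ?thesis using assms unfolding c_def by simp
  next
    case False
    then have c: "0 < c" using \<open>0 \<le> c\<close> by simp
    have "u * (c powr r + r * c powr (r - 1) * (a - c)) + (1 - u) * (c powr r + r * c powr (r - 1) * (b - c))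
        \<le> u * a powr r + (1 - u) * b powr r"
      using powr_tangent_le[OF r c assms(2)] powr_tangent_le[OF r c assms(3)] assms
      by (intro add_mono mult_left_mono) auto
    moreover have "u * (c powr r + r * c powr (r - 1) * (a - c)) + (1 - u) * (c powr r + r * c powr (r - 1) * (b - c))
        = c powr r + r * c powr (r - 1) * (u * a + (1 - u) * b - c)"
      by (simp add: algebra_simps)
    ultimately show ?thesis by (simp add: c_def)
  qed
qed

lemma mean_powr_le:
  fixes a :: "nat \<Rightarrow> real"
  assumes r: "1 \<le> r" and N: "1 \<le> N" and a: "\<And>i. i < N \<Longrightarrow> 0 \<le> a i"
  shows "(1 / real N) * (\<Sum>i<N. a i) \<le> ((1 / real N) * (\<Sum>i<N. a i powr r)) powr (1 / r)"
proof -
  define c where "c = (1 / real N) * (\<Sum>i<N. a i)"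
  have c0: "0 \<le> c" unfolding c_def using a by (auto intro!: divide_nonneg_nonneg sum_nonneg)
  show ?thesis
  proof (cases "c = 0")
    case True
    then show ?thesis unfolding c_def[symmetric] by simp
  next
    case False
    then have c: "0 < c" using c0 by simp
    have Nc: "(\<Sum>i<N. a i) = real N * c" using N by (simp add: c_def)
    have "(\<Sum>i<N. c powr r + r * c powr (r - 1) * (a i - c)) \<le> (\<Sum>i<N. a i powr r)"
      using powr_tangent_le[OF r c a] by (intro sum_mono) auto
    moreover have "(\<Sum>i<N. c powr r + r * c powr (r - 1) * (a i - c)) = real N * c powr r"
      by (simp add: sum.distrib sum_subtractf sum_distrib_left[symmetric] Nc)
    ultimately have "c powr r \<le> (1 / real N) * (\<Sum>i<N. a i powr r)"
      using N by (simp add: field_simps)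
    then have "(c powr r) powr (1 / r) \<le> ((1 / real N) * (\<Sum>i<N. a i powr r)) powr (1 / r)"
      using r by (intro powr_mono2) auto
    then have "c \<le> ((1 / real N) * (\<Sum>i<N. a i powr r)) powr (1 / r)"
      using r c by (simp add: powr_powr)
    then show ?thesis by (simp add: c_def)
  qed
qed

text \<open>Jensen's inequality starting from an extended integral, as a transport cost is given:
  finiteness of the \<open>r\<close>-th moment yields integrability through the domination of
  \<open>X\<close> by \<open>1 + X powr r\<close>, and only then is the tangent at the expectation
  available.\<close>

lemma (in prob_space) expectation_le_of_nn_integral_powr_le:
  fixes X :: "'a \<Rightarrow> real"
  assumes r: "1 \<le> r" and X [measurable]: "X \<in> borel_measurable M" and X0: "\<And>\<omega>. 0 \<le> X \<omega>"
    and c: "0 \<le> c" and le: "(\<integral>\<^sup>+ \<omega>. ennreal (X \<omega> powr r) \<partial>M) \<le> ennreal (c powr r)"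
  shows "integrable M X" "expectation X \<le> c"
proof -
  have fin: "(\<integral>\<^sup>+ \<omega>. ennreal (X \<omega> powr r) \<partial>M) < \<infinity>"
    using le by (simp add: order_le_less_trans less_top)
  have intr: "integrable M (\<lambda>\<omega>. X \<omega> powr r)"
    using fin by (intro integrableI_nonneg) auto
  have "X \<omega> \<le> 1 + X \<omega> powr r" for \<omega>
  proof (cases "X \<omega> \<le> 1")
    case False
    then have "X \<omega> powr 1 \<le> X \<omega> powr r" using r by (intro powr_mono) auto
    then show ?thesis using False by simp
  qed (simp add: add_increasing2)
  then show int: "integrable M X"
    using intr X0 by (intro Bochner_Integration.integrable_bound[of M "\<lambda>\<omega>. 1 + X \<omega> powr r" X]) auto
  show "expectation X \<le> c"
  proof (cases "expectation X = 0")
    case False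
    define e where "e = expectation X"
    have e: "0 < e" using False X0 int by (simp add: e_def order_less_le)
    have "e powr r = expectation (\<lambda>\<omega>. e powr r + r * e powr (r - 1) * (X \<omega> - e))"
      using int by (simp add: e_def[symmetric] prob_space)
    also have "\<dots> \<le> expectation (\<lambda>\<omega>. X \<omega> powr r)"
      using int intr powr_tangent_le[OF r e X0] by (intro integral_mono) auto
    also have "\<dots> \<le> c powr r"
    proof -
      have "ennreal (expectation (\<lambda>\<omega>. X \<omega> powr r)) \<le> ennreal (c powr r)"
        using le intr by (subst (asm) nn_integral_eq_integral) auto
      then show ?thesis by simp
    qed
    finally have "e powr r \<le> c powr r" .
    then have "(e powr r) powr (1 / r) \<le> (c powr r) powr (1 / r)"
      using r by (intro powr_mono2[of "1 / r" "e powr r"]) auto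
    then have "e \<le> c" using r e c by (simp add: powr_powr)
    then show ?thesis by (simp add: e_def)
  qed (use c in simp)
qed

section \<open>The norm of order r and its operator norm\<close>

lemma lr_norm_nonneg [simp]: "0 \<le> lr_norm r v"
  by (simp add: lr_norm_def)

lemma lr_norm_powr: "r \<noteq> 0 \<Longrightarrow> lr_norm r v powr r = (\<Sum>i<dim_vec v. \<bar>v $ i\<bar> powr r)"
  by (simp add: lr_norm_def powr_powr sum_nonneg)

lemma lr_norm_mono:
  assumes "0 < r" "dim_vec v = dim_vec w" "\<And>i. i < dim_vec v \<Longrightarrow> \<bar>v $ i\<bar> \<le> \<bar>w $ i\<bar>"
  shows "lr_norm r v \<le> lr_norm r w"
  unfolding lr_norm_def using assms by (auto intro!: powr_mono2 sum_mono sum_nonneg)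

lemma lr_norm_smult:
  assumes "0 < r"
  shows "lr_norm r (c \<cdot>\<^sub>v v) = \<bar>c\<bar> * lr_norm r v"
proof -
  have "(\<Sum>i<dim_vec v. \<bar>(c \<cdot>\<^sub>v v) $ i\<bar> powr r) = \<bar>c\<bar> powr r * (\<Sum>i<dim_vec v. \<bar>v $ i\<bar> powr r)"
    by (simp add: abs_mult powr_mult sum_distrib_left)
  then show ?thesis using assms by (simp add: lr_norm_def powr_mult sum_nonneg powr_powr)
qed

lemma lr_norm_eq_0_iff:
  assumes "0 < r"
  shows "lr_norm r v = 0 \<longleftrightarrow> v = 0\<^sub>v (dim_vec v)"
proof
  assume "lr_norm r v = 0"
  then have "(\<Sum>i<dim_vec v. \<bar>v $ i\<bar> powr r) = 0" by (simp add: lr_norm_def)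
  then have "\<forall>i<dim_vec v. \<bar>v $ i\<bar> powr r = 0"
    by (subst (asm) sum_nonneg_eq_0_iff) auto
  then show "v = 0\<^sub>v (dim_vec v)" by (intro eq_vecI) auto
next
  assume v: "v = 0\<^sub>v (dim_vec v)"
  have "v $ i = 0" if "i < dim_vec v" for i by (subst v) (simp add: that)
  then show "lr_norm r v = 0" using assms by (simp add: lr_norm_def)
qed

lemma lr_norm_minus_commute:
  assumes "v \<in> carrier_vec d" "w \<in> carrier_vec d"
  shows "lr_norm r (v - w) = lr_norm r (w - v)"
  unfolding lr_norm_def using assms by (auto simp: abs_minus_commute)

text \<open>Minkowski's inequality by convexity: \<open>v + w\<close> is \<open>s + t\<close> times
  the convex combination of \<open>v / s\<close> and \<open>w / t\<close> with weight
  \<open>u = s / (s + t)\<close>, and both normalised vectors have \<open>r\<close>-th powers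
  summing to 1.\<close>

lemma lr_norm_triangle:
  assumes r: "1 \<le> r" and v: "v \<in> carrier_vec d" and w: "w \<in> carrier_vec d"
  shows "lr_norm r (v + w) \<le> lr_norm r v + lr_norm r w"
proof -
  define s t where "s = lr_norm r v" and "t = lr_norm r w"
  have st: "0 \<le> s" "0 \<le> t" by (simp_all add: s_def t_def)
  show ?thesis
  proof (cases "s = 0 \<or> t = 0")
    case True
    then have "v = 0\<^sub>v d \<or> w = 0\<^sub>v d"
      using v w r by (auto simp: s_def t_def lr_norm_eq_0_iff)
    then show ?thesis using v w by auto
  next
    case False
    with st have pos: "0 < s" "0 < t" by auto
    define u where "u = s / (s + t)"
    have u: "0 \<le> u" "u \<le> 1" "1 - u = t / (s + t)" using pos by (simp_all add: u_def field_simps)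
    have coord: "\<bar>(v + w) $ i\<bar> powr r
        \<le> (s + t) powr r * (u * (\<bar>v $ i\<bar> powr r / s powr r) + (1 - u) * (\<bar>w $ i\<bar> powr r / t powr r))"
      if i: "i < d" for i
    proof -
      have "\<bar>(v + w) $ i\<bar> \<le> (s + t) * (u * (\<bar>v $ i\<bar> / s) + (1 - u) * (\<bar>w $ i\<bar> / t))"
        using pos v w i unfolding u(3) by (simp add: u_def distrib_left abs_triangle_ineq)
      then have "\<bar>(v + w) $ i\<bar> powr r \<le> ((s + t) * (u * (\<bar>v $ i\<bar> / s) + (1 - u) * (\<bar>w $ i\<bar> / t))) powr r"
        using r by (intro powr_mono2) auto
      also have "\<dots> = (s + t) powr r * (u * (\<bar>v $ i\<bar> / s) + (1 - u) * (\<bar>w $ i\<bar> / t)) powr r"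
        using pos u by (subst powr_mult) auto
      also have "\<dots> \<le> (s + t) powr r * (u * (\<bar>v $ i\<bar> / s) powr r + (1 - u) * (\<bar>w $ i\<bar> / t) powr r)"
        using pos u r by (intro mult_left_mono powr_convex_comb_le) auto
      finally show ?thesis using pos by (simp add: powr_divide)
    qed
    have sums: "(\<Sum>i<d. \<bar>v $ i\<bar> powr r) = s powr r" "(\<Sum>i<d. \<bar>w $ i\<bar> powr r) = t powr r"
      using r v w lr_norm_powr[of r v] lr_norm_powr[of r w] by (auto simp: s_def t_def)
    have "(\<Sum>i<d. \<bar>(v + w) $ i\<bar> powr r)
        \<le> (\<Sum>i<d. (s + t) powr r * (u * (\<bar>v $ i\<bar> powr r / s powr r) + (1 - u) * (\<bar>w $ i\<bar> powr r / t powr r)))"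
      using coord by (intro sum_mono) auto
    also have "\<dots> = (s + t) powr r * (u * ((\<Sum>i<d. \<bar>v $ i\<bar> powr r) / s powr r)
        + (1 - u) * ((\<Sum>i<d. \<bar>w $ i\<bar> powr r) / t powr r))"
      by (simp add: sum_distrib_left sum.distrib sum_divide_distrib distrib_left)
    also have "\<dots> = (s + t) powr r" unfolding sums using pos by simp
    finally have "lr_norm r (v + w) \<le> ((s + t) powr r) powr (1 / r)"
      unfolding lr_norm_def using v w r by (intro powr_mono2) (auto intro!: sum_nonneg)
    then show ?thesis using pos r by (simp add: powr_powr s_def t_def)
  qed
qed

text \<open>A real supremum bounds its members only if they are bounded above, so that comes first:
  in the unit ball every coordinate is at most 1 in absolute value, and the image is dominated
  coordinatewise by the absolute row sums of \<open>X\<close>. Homogeneity does the rest.\<close>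

lemma lr_norm_mult_le_op_norm:
  assumes r: "1 \<le> r" and X: "X \<in> carrier_mat a b" and v: "v \<in> carrier_vec b"
  shows "lr_norm r (X *\<^sub>v v) \<le> op_norm r X * lr_norm r v"
proof (cases "lr_norm r v = 0")
  case True
  then have "v = 0\<^sub>v b" using v r by (simp add: lr_norm_eq_0_iff)
  then have "X *\<^sub>v v = 0\<^sub>v a" using X by (intro eq_vecI) auto
  then have "lr_norm r (X *\<^sub>v v) = 0" using r by (simp add: lr_norm_eq_0_iff)
  then show ?thesis using True by simp
next
  case False
  define c where "c = lr_norm r v"
  have c: "0 < c" using False by (simp add: c_def order_less_le)
  define S where "S = {w \<in> carrier_vec (dim_col X). lr_norm r w \<le> 1}"
  have bdd: "bdd_above ((\<lambda>w. lr_norm r (X *\<^sub>v w)) ` S)"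
  proof (rule bdd_aboveI2)
    fix w assume "w \<in> S"
    then have w: "w \<in> carrier_vec b" "lr_norm r w \<le> 1" using X by (auto simp: S_def)
    have w1: "\<bar>w $ j\<bar> \<le> 1" if "j < b" for j
    proof -
      have "\<bar>w $ j\<bar> powr r \<le> (\<Sum>j<b. \<bar>w $ j\<bar> powr r)"
        using that by (intro member_le_sum) auto
      also have "\<dots> = lr_norm r w powr r" using w r lr_norm_powr[of r w] by auto
      also have "\<dots> \<le> 1 powr r" using w r by (intro powr_mono2) auto
      finally have "(\<bar>w $ j\<bar> powr r) powr (1 / r) \<le> 1 powr (1 / r)"
        using r by (intro powr_mono2) auto
      then show ?thesis using r by (simp add: powr_powr)
    qed
    show "lr_norm r (X *\<^sub>v w) \<le> lr_norm r (Matrix.vec a (\<lambda>i. \<Sum>j<b. \<bar>X $$ (i, j)\<bar>))"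
    proof (rule lr_norm_mono)
      fix i assume "i < dim_vec (X *\<^sub>v w)"
      then have i: "i < a" using X by auto
      have "\<bar>(X *\<^sub>v w) $ i\<bar> = \<bar>\<Sum>j<b. X $$ (i, j) * w $ j\<bar>"
        using X w i by (auto simp: scalar_prod_def atLeast0LessThan intro!: arg_cong[of _ _ abs] sum.cong)
      also have "\<dots> \<le> (\<Sum>j<b. \<bar>X $$ (i, j) * w $ j\<bar>)" by (rule sum_abs)
      also have "\<dots> \<le> (\<Sum>j<b. \<bar>X $$ (i, j)\<bar>)"
        using w1 by (intro sum_mono) (auto simp: abs_mult intro!: mult_left_le)
      also have "\<dots> \<le> \<bar>Matrix.vec a (\<lambda>i. \<Sum>j<b. \<bar>X $$ (i, j)\<bar>) $ i\<bar>" using i by simp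
      finally show "\<bar>(X *\<^sub>v w) $ i\<bar> \<le> \<bar>Matrix.vec a (\<lambda>i. \<Sum>j<b. \<bar>X $$ (i, j)\<bar>) $ i\<bar>" .
    qed (use r X in auto)
  qed
  have mem: "(1 / c) \<cdot>\<^sub>v v \<in> S"
    using v X r c by (auto simp: S_def lr_norm_smult c_def[symmetric])
  have "lr_norm r (X *\<^sub>v ((1 / c) \<cdot>\<^sub>v v)) \<le> op_norm r X"
    unfolding op_norm_def S_def[symmetric] by (rule cSUP_upper[OF mem bdd])
  moreover have "X *\<^sub>v ((1 / c) \<cdot>\<^sub>v v) = (1 / c) \<cdot>\<^sub>v (X *\<^sub>v v)"
    using X v by (intro mult_mat_vec) auto
  ultimately show ?thesis
    using c r by (simp add: lr_norm_smult c_def[symmetric] field_simps)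
qed

section \<open>Lipschitz functions and expectations\<close>

text \<open>Continuity is expressed on coordinate functions with the product topology, of which
  \<open>Matrix.vec d\<close> reads the first \<open>d\<close> values. Suprema and infima of such
  functions then have open strict level sets.\<close>

lemma continuous_on_lipschitz_vec:
  assumes r: "1 \<le> r" and f: "lipschitz_vec r d L f"
  shows "continuous_on UNIV (\<lambda>z :: nat \<Rightarrow> real. f (Matrix.vec d z))"
proof -
  have "((\<lambda>z'. f (Matrix.vec d z')) \<longlongrightarrow> f (Matrix.vec d z)) (at z)" for z :: "nat \<Rightarrow> real"
  proof -
    define h where "h = (\<lambda>z'. L * (\<Sum>i<d. \<bar>z' i - z i\<bar> powr r) powr (1 / r))"
    have "continuous_on UNIV h"
      unfolding h_def using r
      by (intro continuous_intros continuous_on_powr') (auto intro!: sum_nonneg)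
    then have "(h \<longlongrightarrow> h z) (at z)"
      by (simp add: continuous_on_def)
    moreover have "h z = 0" using r by (simp add: h_def)
    ultimately have "(h \<longlongrightarrow> 0) (at z)" by simp
    moreover have "\<forall>z'. norm (f (Matrix.vec d z') - f (Matrix.vec d z)) \<le> h z'"
    proof
      fix z' :: "nat \<Rightarrow> real"
      have "\<bar>f (Matrix.vec d z') - f (Matrix.vec d z)\<bar> \<le> L * lr_norm r (Matrix.vec d z' - Matrix.vec d z)"
        using f by (simp add: lipschitz_vec_def)
      then show "norm (f (Matrix.vec d z') - f (Matrix.vec d z)) \<le> h z'"
        by (simp add: h_def lr_norm_def)
    qed
    ultimately have "((\<lambda>z'. f (Matrix.vec d z') - f (Matrix.vec d z)) \<longlongrightarrow> 0) (at z)"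
      by (rule Lim_null_comparison[OF always_eventually, rotated])
    then show ?thesis by (simp add: Lim_null[symmetric])
  qed
  then show ?thesis by (simp add: continuous_on_def)
qed

text \<open>Over a countable index type the Borel sets of the product topology form the product
  sigma-algebra, so measurable coordinates suffice.\<close>

lemma measurable_comp_coordinates:
  fixes F :: "('i :: countable \<Rightarrow> real) \<Rightarrow> real"
  assumes F: "F \<in> borel_measurable borel" and X: "\<And>i. (\<lambda>\<omega>. X \<omega> i) \<in> borel_measurable S"
  shows "(\<lambda>\<omega>. F (X \<omega>)) \<in> borel_measurable S"
proof -
  have "X \<in> measurable S (Pi\<^sub>M UNIV (\<lambda>_. borel))"
    using X by (intro measurable_PiM_single') (auto simp: PiE_def extensional_def)
  then have "X \<in> borel_measurable S"
    by (simp add: measurable_cong_sets[OF refl sets_PiM_equal_borel])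
  then show ?thesis using F by (rule measurable_compose)
qed

text \<open>The index set may be uncountable, as for the test functions in the dual distance: a
  strict superlevel set of the supremum is a union of open sets.\<close>

lemma borel_measurable_SUP_continuous:
  fixes F :: "'b \<Rightarrow> 'a :: topological_space \<Rightarrow> real"
  assumes "I \<noteq> {}" "\<And>i. i \<in> I \<Longrightarrow> continuous_on UNIV (F i)" "\<And>z. bdd_above ((\<lambda>i. F i z) ` I)"
  shows "(\<lambda>z. SUP i\<in>I. F i z) \<in> borel_measurable borel"
proof -
  have "open {z. c < (SUP i\<in>I. F i z)}" for c
  proof -
    have "{z. c < (SUP i\<in>I. F i z)} = (\<Union>i\<in>I. {z. c < F i z})"
      using assms by (auto simp: less_cSUP_iff)
    then show ?thesis using assms by (auto intro!: open_UN open_Collect_less)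
  qed
  then show ?thesis by (auto simp: borel_measurable_iff_greater)
qed

text \<open>The mirror image with sublevel sets, for the infimum over all real \<open>t\<close> in
  \<open>cvar\<close>.\<close>

lemma borel_measurable_INF_continuous:
  fixes F :: "'b \<Rightarrow> 'a :: topological_space \<Rightarrow> real"
  assumes "I \<noteq> {}" "\<And>i. i \<in> I \<Longrightarrow> continuous_on UNIV (F i)" "\<And>z. bdd_below ((\<lambda>i. F i z) ` I)"
  shows "(\<lambda>z. INF i\<in>I. F i z) \<in> borel_measurable borel"
proof -
  have "open {z. (INF i\<in>I. F i z) < c}" for c
  proof -
    have "{z. (INF i\<in>I. F i z) < c} = (\<Union>i\<in>I. {z. F i z < c})"
      using assms by (auto simp: cINF_less_iff)
    then show ?thesis using assms by (auto intro!: open_UN open_Collect_less)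
  qed
  then show ?thesis by (auto simp: borel_measurable_iff_less)
qed

lemma measurable_compose_vec:
  assumes F: "(\<lambda>z. f (Matrix.vec d z)) \<in> borel_measurable borel"
    and X: "measurable_vec S d X" "\<And>\<omega>. \<omega> \<in> space S \<Longrightarrow> X \<omega> \<in> carrier_vec d"
  shows "(\<lambda>\<omega>. f (X \<omega>) :: real) \<in> borel_measurable S"
proof -
  \<comment> \<open>Entries with index \<open>d\<close> or more are unspecified and are replaced by
    0.\<close>
  have "(\<lambda>\<omega>. if i < d then X \<omega> $ i else 0) \<in> borel_measurable S" for i
    using X(1) by (cases "i < d") (auto simp: measurable_vec_def)
  from measurable_comp_coordinates[OF F this]
  have "(\<lambda>\<omega>. f (Matrix.vec d (\<lambda>i. if i < d then X \<omega> $ i else 0))) \<in> borel_measurable S" .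
  moreover have "Matrix.vec d (\<lambda>i. if i < d then X \<omega> $ i else 0) = X \<omega>" if "\<omega> \<in> space S" for \<omega>
    using X(2)[OF that] by (intro eq_vecI) auto
  ultimately show ?thesis by (subst (asm) measurable_cong) auto
qed

lemma measurable_lipschitz_vec:
  assumes "1 \<le> r" "lipschitz_vec r d L f"
    and X: "measurable_vec S d X" "\<And>\<omega>. \<omega> \<in> space S \<Longrightarrow> X \<omega> \<in> carrier_vec d"
  shows "(\<lambda>\<omega>. f (X \<omega>)) \<in> borel_measurable S"
proof -
  have F: "(\<lambda>z. f (Matrix.vec d z)) \<in> borel_measurable borel"
    by (rule borel_measurable_continuous_onI) (rule continuous_on_lipschitz_vec[OF assms(1,2)])
  show ?thesis by (rule measurable_compose_vec[where f = f and d = d and X = X, OF F X])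
qed

section \<open>The sigma-algebra \<open>borel_vec\<close>\<close>

lemma space_borel_vec [simp]: "space (borel_vec d) = carrier_vec d"
  by (simp add: borel_vec_def)

lemma measurable_borel_vecI:
  assumes "measurable_vec S d X" "\<And>\<omega>. \<omega> \<in> space S \<Longrightarrow> X \<omega> \<in> carrier_vec d"
  shows "X \<in> measurable S (borel_vec d)"
  unfolding borel_vec_def
  using assms by (intro measurable_vimage_algebra2 measurable_restrict) (auto simp: measurable_vec_def)

lemma measurable_borel_vecD:
  assumes "X \<in> measurable S (borel_vec d)"
  shows "measurable_vec S d X" "\<And>\<omega>. \<omega> \<in> space S \<Longrightarrow> X \<omega> \<in> carrier_vec d"
proof -
  show "\<And>\<omega>. \<omega> \<in> space S \<Longrightarrow> X \<omega> \<in> carrier_vec d"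
    using measurable_space[OF assms] by simp
  show "measurable_vec S d X"
    unfolding measurable_vec_def
  proof (intro allI impI)
    fix i assume i: "i < d"
    have "(\<lambda>v. \<lambda>i\<in>{..<d}. v $ i) \<in> measurable (borel_vec d) (\<Pi>\<^sub>M i\<in>{..<d}. borel :: real measure)"
      unfolding borel_vec_def by (intro measurable_vimage_algebra1) (auto simp: space_PiM)
    from measurable_compose[OF assms measurable_compose[OF this measurable_component_singleton[of i]]]
    have "(\<lambda>\<omega>. (\<lambda>i\<in>{..<d}. X \<omega> $ i) i) \<in> borel_measurable S" using i by simp
    then show "(\<lambda>\<omega>. X \<omega> $ i) \<in> borel_measurable S" using i by simp
  qed
qed

lemma measurable_vec_add:
  assumes X: "measurable_vec S d X" and Y: "measurable_vec S d Y"
    and "\<And>\<omega>. \<omega> \<in> space S \<Longrightarrow> Y \<omega> \<in> carrier_vec d"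
  shows "measurable_vec S d (\<lambda>\<omega>. X \<omega> + Y \<omega>)"
  unfolding measurable_vec_def
proof (intro allI impI)
  fix i assume i: "i < d"
  have "(\<lambda>\<omega>. X \<omega> $ i + Y \<omega> $ i) \<in> borel_measurable S"
    using X Y i unfolding measurable_vec_def by (intro borel_measurable_add) auto
  moreover have "(X \<omega> + Y \<omega>) $ i = X \<omega> $ i + Y \<omega> $ i" if "\<omega> \<in> space S" for \<omega>
    using assms(3)[OF that] i by simp
  ultimately show "(\<lambda>\<omega>. (X \<omega> + Y \<omega>) $ i) \<in> borel_measurable S"
    by (subst measurable_cong) auto
qed

lemma measurable_vec_minus:
  assumes X: "measurable_vec S d X" and Y: "measurable_vec S d Y"
    and "\<And>\<omega>. \<omega> \<in> space S \<Longrightarrow> Y \<omega> \<in> carrier_vec d"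
  shows "measurable_vec S d (\<lambda>\<omega>. X \<omega> - Y \<omega>)"
  unfolding measurable_vec_def
proof (intro allI impI)
  fix i assume i: "i < d"
  have "(\<lambda>\<omega>. X \<omega> $ i - Y \<omega> $ i) \<in> borel_measurable S"
    using X Y i unfolding measurable_vec_def by (intro borel_measurable_diff) auto
  moreover have "(X \<omega> - Y \<omega>) $ i = X \<omega> $ i - Y \<omega> $ i" if "\<omega> \<in> space S" for \<omega>
    using assms(3)[OF that] i by simp
  ultimately show "(\<lambda>\<omega>. (X \<omega> - Y \<omega>) $ i) \<in> borel_measurable S"
    by (subst measurable_cong) auto
qed

lemma measurable_vec_const: "measurable_vec S d (\<lambda>_. v)"
  by (simp add: measurable_vec_def)

lemma lipschitz_lr_norm:
  assumes r: "1 \<le> r"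
  shows "lipschitz_vec r d 1 (lr_norm r)"
  unfolding lipschitz_vec_def
proof (intro ballI)
  fix v w :: "real vec" assume v: "v \<in> carrier_vec d" and w: "w \<in> carrier_vec d"
  have "(v - w) + w = v" "(w - v) + v = w" using v w by (auto intro!: eq_vecI)
  then have "lr_norm r v \<le> lr_norm r (v - w) + lr_norm r w" "lr_norm r w \<le> lr_norm r (w - v) + lr_norm r v"
    using lr_norm_triangle[OF r, of "v - w" d w] lr_norm_triangle[OF r, of "w - v" d v] v w by auto
  then show "\<bar>lr_norm r v - lr_norm r w\<bar> \<le> 1 * lr_norm r (v - w)"
    using lr_norm_minus_commute[OF v w, of r] by simp
qed

section \<open>Operations that preserve Lipschitz bounds\<close>

lemma lipschitz_vecD:
  assumes "lipschitz_vec r d L f" "v \<in> carrier_vec d" "w \<in> carrier_vec d"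
  shows "f v \<le> f w + L * lr_norm r (v - w)" "\<bar>f v - f w\<bar> \<le> L * lr_norm r (v - w)"
  using assms unfolding lipschitz_vec_def by force+

lemma lipschitz_vec_translate:
  assumes f: "lipschitz_vec r d L f" and c: "c \<in> carrier_vec d"
  shows "lipschitz_vec r d L (\<lambda>z. f (c + z))"
  unfolding lipschitz_vec_def
proof (intro ballI)
  fix v w :: "real vec" assume vw: "v \<in> carrier_vec d" "w \<in> carrier_vec d"
  have "(c + v) - (c + w) = v - w" using vw c by (intro eq_vecI) auto
  then show "\<bar>f (c + v) - f (c + w)\<bar> \<le> L * lr_norm r (v - w)"
    using lipschitz_vecD(2)[OF f, of "c + v" "c + w"] vw c by simp
qed

lemma lipschitz_vec_scale:
  assumes f: "lipschitz_vec r d L f" and L: "0 < L"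
  shows "lipschitz_vec r d 1 (\<lambda>z. f z / L)"
  unfolding lipschitz_vec_def
proof (intro ballI)
  fix v w :: "real vec" assume vw: "v \<in> carrier_vec d" "w \<in> carrier_vec d"
  show "\<bar>f v / L - f w / L\<bar> \<le> 1 * lr_norm r (v - w)"
    using lipschitz_vecD(2)[OF f vw] L by (simp add: diff_divide_distrib[symmetric] field_simps)
qed

lemma lipschitz_vec_hinge:
  assumes f: "lipschitz_vec r d L f"
  shows "lipschitz_vec r d L (\<lambda>z. max (f z - t) 0)"
  unfolding lipschitz_vec_def
proof (intro ballI)
  fix v w :: "real vec" assume vw: "v \<in> carrier_vec d" "w \<in> carrier_vec d"
  show "\<bar>max (f v - t) 0 - max (f w - t) 0\<bar> \<le> L * lr_norm r (v - w)"
    using lipschitz_vecD(2)[OF f vw] by linarith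
qed

lemma borel_measurable_lipschitz_vec:
  assumes r: "1 \<le> r" and f: "lipschitz_vec r d L f"
  shows "f \<in> borel_measurable (borel_vec d)"
  using measurable_borel_vecD[OF measurable_ident[of "borel_vec d"]]
  by (intro measurable_lipschitz_vec[OF r f, where X = "\<lambda>x. x"]) (auto simp: id_def)

text \<open>Instantiated with the disturbance law \<open>Pxi\<close>. A finite first moment is
  exactly what makes every Lipschitz function integrable.\<close>

locale first_moment_law = prob_space Q for Q :: "real vec measure" +
  fixes r :: real and d :: nat
  assumes r: "1 \<le> r" and sets_Q: "sets Q = sets (borel_vec d)" and integrable_norm: "integrable Q (lr_norm r)"
begin

lemma space_Q [simp]: "space Q = carrier_vec d"
  using sets_eq_imp_space_eq[OF sets_Q] by simp

lemma prob_carrier_vec [simp]: "prob (carrier_vec d) = 1"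
  using prob_space by simp

lemma measurable_Q: "lipschitz_vec r d L f \<Longrightarrow> f \<in> borel_measurable Q"
  using borel_measurable_lipschitz_vec[OF r] by (simp add: measurable_cong_sets[OF sets_Q refl])

lemma integrable_lipschitz:
  assumes f: "lipschitz_vec r d L f"
  shows "integrable Q f"
proof (rule Bochner_Integration.integrable_bound)
  show "integrable Q (\<lambda>z. \<bar>f (0\<^sub>v d)\<bar> + \<bar>L\<bar> * lr_norm r z)"
    using integrable_norm by simp
  show "f \<in> borel_measurable Q" by (rule measurable_Q[OF f])
  show "AE z in Q. norm (f z) \<le> norm (\<bar>f (0\<^sub>v d)\<bar> + \<bar>L\<bar> * lr_norm r z)"
  proof (rule AE_I2)
    fix z assume "z \<in> space Q"
    then have z: "z \<in> carrier_vec d" by simp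
    have "\<bar>f z - f (0\<^sub>v d)\<bar> \<le> L * lr_norm r z"
      using lipschitz_vecD(2)[OF f z zero_carrier_vec] z by simp
    also have "\<dots> \<le> \<bar>L\<bar> * lr_norm r z" by (intro mult_right_mono) auto
    finally show "norm (f z) \<le> norm (\<bar>f (0\<^sub>v d)\<bar> + \<bar>L\<bar> * lr_norm r z)" by simp
  qed
qed

text \<open>The shift cancels in differences, so the bound survives integration. Hence the
  expectation is a measurable function of a random shift such as
  \<open>K *\<^sub>v mf \<omega>\<close>.\<close>

lemma lipschitz_expectation_translate:
  assumes f: "lipschitz_vec r d L f"
  shows "lipschitz_vec r d L (\<lambda>c. \<integral>z. f (c + z) \<partial>Q)"
  unfolding lipschitz_vec_def
proof (intro ballI)
  fix v w :: "real vec" assume v: "v \<in> carrier_vec d" and w: "w \<in> carrier_vec d"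
  have int: "integrable Q (\<lambda>z. f (v + z))" "integrable Q (\<lambda>z. f (w + z))"
    using integrable_lipschitz[OF lipschitz_vec_translate[OF f]] v w by auto
  have "\<bar>(\<integral>z. f (v + z) \<partial>Q) - (\<integral>z. f (w + z) \<partial>Q)\<bar> = \<bar>\<integral>z. f (v + z) - f (w + z) \<partial>Q\<bar>"
    using int by simp
  also have "\<dots> \<le> (\<integral>z. \<bar>f (v + z) - f (w + z)\<bar> \<partial>Q)"
    by (rule integral_abs_bound)
  also have "\<dots> \<le> (\<integral>z. L * lr_norm r (v - w) \<partial>Q)"
  proof (rule integral_mono)
    fix z assume "z \<in> space Q"
    then have z: "z \<in> carrier_vec d" by simp
    have "(v + z) - (w + z) = v - w" using v w z by (intro eq_vecI) auto
    then show "\<bar>f (v + z) - f (w + z)\<bar> \<le> L * lr_norm r (v - w)"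
      using lipschitz_vecD(2)[OF f, of "v + z" "w + z"] v w z by simp
  qed (use int in auto)
  finally show "\<bar>(\<integral>z. f (v + z) \<partial>Q) - (\<integral>z. f (w + z) \<partial>Q)\<bar> \<le> L * lr_norm r (v - w)"
    by (simp add: prob_space)
qed

text \<open>
  The dual (Kantorovich-Rubinstein) form of the distance between \<open>Q\<close> and the empirical law at the points \<open>a\<close>.
  It replaces the Wasserstein distance because, as a supremum of continuous functions
  of the points, it is measurable; for a possibly non-measurable integrand \<open>\<integral>\<^sup>+\<close> is only a lower integral, to
  which Markov's inequality does not apply.
\<close>

definition gap :: "nat \<Rightarrow> (nat \<Rightarrow> real vec) \<Rightarrow> real" where
  "gap N a = (SUP \<phi>\<in>{\<phi>. lipschitz_vec r d 1 \<phi>}. (\<integral>z. \<phi> z \<partial>Q) - (1 / real N) * (\<Sum>i<N. \<phi> (a i)))"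

lemma gap_cong:
  assumes "\<And>i. i < N \<Longrightarrow> a i = b i"
  shows "gap N a = gap N b"
proof -
  have "(\<Sum>i<N. \<phi> (a i)) = (\<Sum>i<N. \<phi> (b i))" for \<phi> :: "real vec \<Rightarrow> real"
    using assms by (intro sum.cong) auto
  then show ?thesis by (simp add: gap_def)
qed

text \<open>Both averages reproduce the constant \<open>\<phi> (0\<^sub>v d)\<close>, which
  therefore cancels; what remains is at most the first moments of \<open>Q\<close> and of the
  points, uniformly in \<open>\<phi>\<close>.\<close>

lemma bdd_above_gap:
  assumes a: "\<And>i. i < N \<Longrightarrow> a i \<in> carrier_vec d" and N: "1 \<le> N"
  shows "bdd_above ((\<lambda>\<phi>. (\<integral>z. \<phi> z \<partial>Q) - (1 / real N) * (\<Sum>i<N. \<phi> (a i))) ` {\<phi>. lipschitz_vec r d 1 \<phi>})"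
proof (rule bdd_aboveI2)
  fix \<phi> assume "\<phi> \<in> {\<phi>. lipschitz_vec r d 1 \<phi>}"
  then have \<phi>: "lipschitz_vec r d 1 \<phi>" by simp
  have "(\<integral>z. \<phi> z \<partial>Q) \<le> (\<integral>z. \<phi> (0\<^sub>v d) + lr_norm r z \<partial>Q)"
    using integrable_lipschitz[OF \<phi>] integrable_norm lipschitz_vecD(1)[OF \<phi> _ zero_carrier_vec]
    by (intro integral_mono) auto
  also have "\<dots> = \<phi> (0\<^sub>v d) + (\<integral>z. lr_norm r z \<partial>Q)"
    using integrable_norm by (simp add: prob_space)
  finally have 1: "(\<integral>z. \<phi> z \<partial>Q) \<le> \<phi> (0\<^sub>v d) + (\<integral>z. lr_norm r z \<partial>Q)" .
  have "(\<Sum>i<N. \<phi> (0\<^sub>v d) - lr_norm r (a i)) \<le> (\<Sum>i<N. \<phi> (a i))"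
  proof (rule sum_mono)
    fix i assume "i \<in> {..<N}"
    then have "a i \<in> carrier_vec d" using a by simp
    then show "\<phi> (0\<^sub>v d) - lr_norm r (a i) \<le> \<phi> (a i)"
      using lipschitz_vecD(1)[OF \<phi> zero_carrier_vec, of "a i"] lr_norm_minus_commute[of "a i" d "0\<^sub>v d" r] by simp
  qed
  then have "\<phi> (0\<^sub>v d) - (1 / real N) * (\<Sum>i<N. lr_norm r (a i)) \<le> (1 / real N) * (\<Sum>i<N. \<phi> (a i))"
  proof -
    assume "(\<Sum>i<N. \<phi> (0\<^sub>v d) - lr_norm r (a i)) \<le> (\<Sum>i<N. \<phi> (a i))"
    then have "(1 / real N) * (\<Sum>i<N. \<phi> (0\<^sub>v d) - lr_norm r (a i)) \<le> (1 / real N) * (\<Sum>i<N. \<phi> (a i))"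
      by (intro mult_left_mono) auto
    then show ?thesis using N by (simp add: sum_subtractf diff_divide_distrib)
  qed
  with 1 show "(\<integral>z. \<phi> z \<partial>Q) - (1 / real N) * (\<Sum>i<N. \<phi> (a i))
      \<le> (\<integral>z. lr_norm r z \<partial>Q) + (1 / real N) * (\<Sum>i<N. lr_norm r (a i))"
    by linarith
qed

text \<open>\<open>f / L\<close> is one of the functions over which the supremum is taken.\<close>

lemma gap_upper:
  assumes a: "\<And>i. i < N \<Longrightarrow> a i \<in> carrier_vec d" and N: "1 \<le> N"
    and L: "0 < L" and f: "lipschitz_vec r d L f"
  shows "(\<integral>z. f z \<partial>Q) \<le> (1 / real N) * (\<Sum>i<N. f (a i)) + L * gap N a"
proof -
  have "(\<integral>z. f z / L \<partial>Q) - (1 / real N) * (\<Sum>i<N. f (a i) / L) \<le> gap N a"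
    unfolding gap_def
    by (rule cSUP_upper2[OF bdd_above_gap[OF a N], where x = "\<lambda>z. f z / L"])
      (auto intro!: lipschitz_vec_scale[OF f L])
  then show ?thesis
    using L by (simp add: sum_divide_distrib[symmetric] field_simps)
qed

lemma zero_lipschitz: "lipschitz_vec r d 1 (\<lambda>_. 0)"
  by (simp add: lipschitz_vec_def)

lemma gap_nonneg:
  assumes a: "\<And>i. i < N \<Longrightarrow> a i \<in> carrier_vec d" and N: "1 \<le> N"
  shows "0 \<le> gap N a"
  unfolding gap_def
  by (rule cSUP_upper2[OF bdd_above_gap[OF a N], where x = "\<lambda>_. 0"]) (auto intro!: zero_lipschitz)

lemma measurable_gap:
  assumes N: "1 \<le> N"
    and a: "\<And>i. i < N \<Longrightarrow> measurable_vec S d (a i)" "\<And>i \<omega>. i < N \<Longrightarrow> \<omega> \<in> space S \<Longrightarrow> a i \<omega> \<in> carrier_vec d"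
  shows "(\<lambda>\<omega>. gap N (\<lambda>i. a i \<omega>)) \<in> borel_measurable S"
proof -
  \<comment> \<open>The coordinates of all points form one family over pairs of indices, a countable
    type, so that measurability can be checked coordinate by coordinate.\<close>
  define F where "F = (\<lambda>z :: nat \<times> nat \<Rightarrow> real. gap N (\<lambda>i. Matrix.vec d (\<lambda>k. z (i, k))))"
  have "F \<in> borel_measurable borel"
    unfolding F_def gap_def
  proof (rule borel_measurable_SUP_continuous)
    show "{\<phi>. lipschitz_vec r d 1 \<phi>} \<noteq> {}" using zero_lipschitz by auto
    fix \<phi> assume "\<phi> \<in> {\<phi>. lipschitz_vec r d 1 \<phi>}"
    then have c: "continuous_on UNIV (\<lambda>z :: nat \<Rightarrow> real. \<phi> (Matrix.vec d z))"
      using continuous_on_lipschitz_vec[OF r] by blast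
    have "continuous_on UNIV (\<lambda>z :: nat \<times> nat \<Rightarrow> real. \<phi> (Matrix.vec d (\<lambda>k. z (i, k))))" for i
      by (rule continuous_on_compose2[OF c]) (auto intro!: continuous_on_coordinatewise_then_product)
    then show "continuous_on UNIV (\<lambda>z :: nat \<times> nat \<Rightarrow> real.
        (\<integral>z. \<phi> z \<partial>Q) - (1 / real N) * (\<Sum>i<N. \<phi> (Matrix.vec d (\<lambda>k. z (i, k)))))"
      by (intro continuous_intros)
  qed (rule bdd_above_gap[OF _ N], simp)
  moreover have "(\<lambda>\<omega>. if fst ik < N \<and> snd ik < d then a (fst ik) \<omega> $ snd ik else 0) \<in> borel_measurable S" for ik
    using a(1)[of "fst ik"] by (cases "fst ik < N \<and> snd ik < d") (auto simp: measurable_vec_def)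
  ultimately have "(\<lambda>\<omega>. F (\<lambda>ik. if fst ik < N \<and> snd ik < d then a (fst ik) \<omega> $ snd ik else 0)) \<in> borel_measurable S"
    by (rule measurable_comp_coordinates)
  moreover have "F (\<lambda>ik. if fst ik < N \<and> snd ik < d then a (fst ik) \<omega> $ snd ik else 0) = gap N (\<lambda>i. a i \<omega>)"
    if "\<omega> \<in> space S" for \<omega>
  proof -
    show ?thesis
      unfolding F_def
    proof (rule gap_cong)
      fix i assume "i < N"
      then show "Matrix.vec d (\<lambda>k. if fst (i, k) < N \<and> snd (i, k) < d then a (fst (i, k)) \<omega> $ snd (i, k) else 0) = a i \<omega>"
        using a(2)[of i \<omega>] that by (intro eq_vecI) auto
    qed
  qed
  ultimately show ?thesis by (subst (asm) measurable_cong) auto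
qed

end

lemma ennpowr_inverse:
  assumes "r \<noteq> 0"
  shows "ennpowr (ennpowr x (1 / r)) r = x"
  using assms by (cases x) (auto simp: ennpowr_def powr_powr)

context first_moment_law
begin

text \<open>The easy half of Kantorovich-Rubinstein duality: under a coupling, the difference of the
  two averages of \<open>\<phi>\<close> is the mean of
  \<open>\<phi> (snd z) - \<phi> (fst z)\<close>, at most the mean distance, which Jensen's
  inequality bounds by the \<open>r\<close>-th root of the cost. An infinite cost makes the claim
  trivial.\<close>

lemma gap_le_coupling:
  assumes N: "1 \<le> N" and a: "\<And>i. i < N \<Longrightarrow> a i \<in> carrier_vec d"
    and R: "R \<in> couplings (distr (uniform_count_measure {..<N}) (borel_vec d) a) Q"
  shows "ennreal (gap N a powr r) \<le> (\<integral>\<^sup>+ z. ennreal (lr_norm r (fst z - snd z) powr r) \<partial>R)"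
    (is "_ \<le> ?X")
proof (cases "?X = \<top>")
  case False
  define E where "E = distr (uniform_count_measure {..<N}) (borel_vec d) a"
  have a_meas: "a \<in> measurable (uniform_count_measure {..<N}) (borel_vec d)"
    using a by (auto simp: measurable_def sets_uniform_count_measure space_uniform_count_measure)
  have R': "sets R = sets (E \<Otimes>\<^sub>M Q)" "distr R E fst = E" "distr R Q snd = Q"
    using R by (auto simp: couplings_def E_def)
  have fst_R: "fst \<in> measurable R E" and snd_R: "snd \<in> measurable R Q"
    by (simp_all add: measurable_cong_sets[OF R'(1) refl])
  have [simp]: "space E = carrier_vec d" by (simp add: E_def)
  have space_R: "space R = carrier_vec d \<times> carrier_vec d"
    using sets_eq_imp_space_eq[OF R'(1)] by (simp add: space_pair_measure)
  \<comment> \<open>A coupling has mass 1 because its second marginal \<open>Q\<close> does.\<close>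
  interpret R: prob_space R
    by (rule prob_space_distrD[OF snd_R]) (simp add: R'(3) prob_space_axioms)
  define X where "X = (\<lambda>z :: real vec \<times> real vec. lr_norm r (fst z - snd z))"
  have fst_R': "fst \<in> measurable R (borel_vec d)"
    using fst_R by (simp add: E_def measurable_cong_sets[OF refl sets_distr])
  have snd_R': "snd \<in> measurable R (borel_vec d)"
    using snd_R by (simp add: measurable_cong_sets[OF refl sets_Q])
  have X: "X \<in> borel_measurable R"
    unfolding X_def
    by (rule measurable_lipschitz_vec[OF r lipschitz_lr_norm[OF r]])
      (auto intro!: measurable_vec_minus measurable_borel_vecD(1)[OF fst_R'] measurable_borel_vecD(1)[OF snd_R'] simp: space_R)
  define c where "c = enn2real ?X powr (1 / r)"
  have c: "0 \<le> c" "?X = ennreal (c powr r)"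
    using False r by (auto simp: c_def powr_powr less_top)
  have EX: "integrable R X" "R.expectation X \<le> c"
    using R.expectation_le_of_nn_integral_powr_le[OF r X _ c(1)] c(2) by (auto simp: X_def)
  have "gap N a \<le> c"
    unfolding gap_def
  proof (rule cSUP_least)
    show "{\<phi>. lipschitz_vec r d 1 \<phi>} \<noteq> {}" using zero_lipschitz by auto
    fix \<phi> assume "\<phi> \<in> {\<phi>. lipschitz_vec r d 1 \<phi>}"
    then have \<phi>: "lipschitz_vec r d 1 \<phi>" by simp
    have \<phi>E: "\<phi> \<in> borel_measurable E" and \<phi>b: "\<phi> \<in> borel_measurable (borel_vec d)"
      using borel_measurable_lipschitz_vec[OF r \<phi>] by (simp_all add: E_def)
    have 1: "(\<integral>z. \<phi> z \<partial>Q) = (\<integral>z. \<phi> (snd z) \<partial>R)"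
      by (subst R'(3)[symmetric]) (rule integral_distr[OF snd_R measurable_Q[OF \<phi>]])
    have i1: "integrable R (\<lambda>z. \<phi> (snd z))"
      using integrable_distr_eq[OF snd_R measurable_Q[OF \<phi>]] integrable_lipschitz[OF \<phi>] by (simp add: R'(3))
    have "(\<integral>z. \<phi> (fst z) \<partial>R) = (\<integral>z. \<phi> z \<partial>E)"
      by (subst R'(2)[symmetric]) (rule integral_distr[OF fst_R \<phi>E, symmetric])
    also have "\<dots> = (\<integral>i. \<phi> (a i) \<partial>uniform_count_measure {..<N})"
      unfolding E_def by (rule integral_distr[OF a_meas \<phi>b])
    also have "\<dots> = (1 / real N) * (\<Sum>i<N. \<phi> (a i))"
      by (simp add: integral_uniform_count_measure)
    finally have 2: "(\<integral>z. \<phi> (fst z) \<partial>R) = (1 / real N) * (\<Sum>i<N. \<phi> (a i))" .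
    have "integrable (uniform_count_measure {..<N}) (\<lambda>i. \<phi> (a i))"
      by (simp add: uniform_count_measure_def integrable_point_measure_finite)
    then have "integrable E \<phi>"
      unfolding E_def by (simp add: integrable_distr_eq[OF a_meas \<phi>b])
    then have i2: "integrable R (\<lambda>z. \<phi> (fst z))"
      using integrable_distr_eq[OF fst_R \<phi>E] by (simp add: R'(2))
    have "(\<integral>z. \<phi> z \<partial>Q) - (1 / real N) * (\<Sum>i<N. \<phi> (a i)) = (\<integral>z. \<phi> (snd z) - \<phi> (fst z) \<partial>R)"
      unfolding 1 2[symmetric] using i1 i2 by simp
    also have "\<dots> \<le> (\<integral>z. X z \<partial>R)"
    proof (rule integral_mono)
      fix z assume "z \<in> space R"
      then have z: "fst z \<in> carrier_vec d" "snd z \<in> carrier_vec d" by (auto simp: space_R)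
      show "\<phi> (snd z) - \<phi> (fst z) \<le> X z"
        using lipschitz_vecD(1)[OF \<phi> z(2,1)] lr_norm_minus_commute[OF z, of r] by (simp add: X_def)
    qed (use i1 i2 EX in auto)
    finally show "(\<integral>z. \<phi> z \<partial>Q) - (1 / real N) * (\<Sum>i<N. \<phi> (a i)) \<le> c" using EX by simp
  qed
  then show ?thesis
    unfolding c(2) using r gap_nonneg[OF a N] by (intro ennreal_leI powr_mono2) auto
qed simp

text \<open>The bound holds for every coupling and so passes to the infimum, attained or not; the
  outer power \<open>r\<close> undoes the root in \<open>wasserstein\<close>.\<close>

lemma gap_le_wasserstein:
  assumes N: "1 \<le> N" and a: "\<And>i. i < N \<Longrightarrow> a i \<in> carrier_vec d"
  shows "ennreal (gap N a powr r)
    \<le> ennpowr (wasserstein r (distr (uniform_count_measure {..<N}) (borel_vec d) a) Q) r"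
  using r gap_le_coupling[OF N a]
  by (auto simp: wasserstein_def ennpowr_inverse intro!: INF_greatest)

text \<open>Since \<open>1 / \<beta>\<close> is at least 1 and the hinge dominates
  \<open>f - t\<close>, the plain expectation is a lower bound for every \<open>t\<close>. Without
  such a bound the real infimum in \<open>cvar\<close> could not be estimated by its value at a
  chosen \<open>t\<close>.\<close>

lemma bdd_below_cvar:
  assumes f: "lipschitz_vec r d L f" and \<beta>: "\<beta> \<in> {0<..<1}" and c: "c \<in> carrier_vec d"
  shows "bdd_below (range (\<lambda>t. (1 / \<beta>) * (\<integral>z. max (f (c + z) - t) 0 \<partial>Q) + t))"
proof (rule bdd_belowI2)
  fix t
  have int: "integrable Q (\<lambda>z. f (c + z))" "integrable Q (\<lambda>z. max (f (c + z) - t) 0)"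
    using integrable_lipschitz[OF lipschitz_vec_translate[OF f c]]
      integrable_lipschitz[OF lipschitz_vec_translate[OF lipschitz_vec_hinge[OF f] c]] by auto
  have "(\<integral>z. f (c + z) \<partial>Q) - t = (\<integral>z. f (c + z) - t \<partial>Q)" using int by (simp add: prob_space)
  also have "\<dots> \<le> (\<integral>z. max (f (c + z) - t) 0 \<partial>Q)" using int by (intro integral_mono) auto
  also have "\<dots> \<le> (1 / \<beta>) * (\<integral>z. max (f (c + z) - t) 0 \<partial>Q)"
  proof -
    have "0 \<le> (\<integral>z. max (f (c + z) - t) 0 \<partial>Q)" by (intro integral_nonneg_AE) auto
    moreover have "1 \<le> 1 / \<beta>" using \<beta> by simp
    ultimately show ?thesis by (metis mult_right_mono mult_1)
  qed
  finally show "(\<integral>z. f (c + z) \<partial>Q) \<le> (1 / \<beta>) * (\<integral>z. max (f (c + z) - t) 0 \<partial>Q) + t" by simp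
qed

text \<open>For each fixed \<open>t\<close> the objective is continuous in the shift, because the
  expected hinge is Lipschitz in it.\<close>

lemma measurable_cvar_translate:
  assumes f: "lipschitz_vec r d L f" and \<beta>: "\<beta> \<in> {0<..<1}"
  shows "(\<lambda>z. INF t. (1 / \<beta>) * (\<integral>x. max (f (Matrix.vec d z + x) - t) 0 \<partial>Q) + t) \<in> borel_measurable borel"
proof (rule borel_measurable_INF_continuous)
  fix t :: real
  have "continuous_on UNIV (\<lambda>z. \<integral>x. max (f (Matrix.vec d z + x) - t) 0 \<partial>Q)"
    using continuous_on_lipschitz_vec[OF r lipschitz_expectation_translate[OF lipschitz_vec_hinge[OF f]]] .
  then show "continuous_on UNIV (\<lambda>z. (1 / \<beta>) * (\<integral>x. max (f (Matrix.vec d z + x) - t) 0 \<partial>Q) + t)"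
    by (intro continuous_intros)
next
  fix z :: "nat \<Rightarrow> real"
  show "bdd_below (range (\<lambda>t. (1 / \<beta>) * (\<integral>x. max (f (Matrix.vec d z + x) - t) 0 \<partial>Q) + t))"
    by (rule bdd_below_cvar[OF f \<beta>]) simp
qed simp

end

section \<open>The data-driven bound\<close>

context first_moment_law
begin

text \<open>The deterministic core, for one realisation of the data: randomness is hidden in the two
  premises on \<open>e1\<close> and \<open>e2\<close>, and \<open>f\<close> is any Lipschitz
  function.\<close>

lemma expectation_le_scenario_mean:
  assumes M: "M \<in> carrier_mat c N" and Yf: "Yf \<in> carrier_mat d N" and K: "K \<in> carrier_mat d c"
    and N: "1 \<le> N" and g: "g \<in> carrier_vec N" and g_row: "(1\<^sub>m N - pinv M * M) *\<^sub>v g = 0\<^sub>v N"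
    and mf: "mf = M *\<^sub>v g"
    and e1: "op_norm r (K - Yf * pinv M) \<le> e1" "0 \<le> e1"
    and e2: "gap N (\<lambda>i. (Yf - K * M) *\<^sub>v unit_vec N i) \<le> e2"
    and L: "0 < L" and f: "lipschitz_vec r d L f"
  shows "(\<integral>z. f (K *\<^sub>v mf + z) \<partial>Q)
    \<le> (1 / real N) * (\<Sum>i<N. f (scenario M Yf g i)) + L * radius r e1 e2 M mf"
proof -
  have pM: "pinv M \<in> carrier_mat N c"
    using pinv_moore_penrose[of M] M by (auto simp: is_moore_penrose_def)
  define P H where "P = pinv M * M" and "H = Yf * pinv M"
  define a where "a = (\<lambda>i. (Yf - K * M) *\<^sub>v unit_vec N i)"
  define nrm where "nrm = (\<lambda>i. lr_norm r (M *\<^sub>v unit_vec N i - mf))"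
  have P: "P \<in> carrier_mat N N" using pM M by (simp add: P_def)
  have H: "H \<in> carrier_mat d c" using pM Yf by (simp add: H_def)
  have mfc: "mf \<in> carrier_vec c" using M g by (simp add: mf)
  have Kmf: "K *\<^sub>v mf \<in> carrier_vec d" using K mfc by (rule mult_mat_vec_carrier)
  have ac: "a i \<in> carrier_vec d" for i using K M Yf by (intro carrier_vecI) (simp add: a_def)
  have YfP: "Yf * P = H * M" using Yf pM M by (simp add: P_def H_def)
  have sc: "scenario M Yf g i \<in> carrier_vec d" for i
    using Yf by (intro carrier_vecI) (simp add: scenario_def)
  have Pg: "P *\<^sub>v g = g"
  proof -
    have "g - P *\<^sub>v g = 0\<^sub>v N"
      using g_row minus_mult_distrib_mat_vec[of "1\<^sub>m N" N N P g] P g by (simp add: P_def[symmetric])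
    then have "(g - P *\<^sub>v g) $ i = 0" if "i < N" for i using that by simp
    then show ?thesis using P g by (intro eq_vecI) auto
  qed
  have diff: "K *\<^sub>v mf + a i - scenario M Yf g i = (K - H) *\<^sub>v (mf - M *\<^sub>v unit_vec N i)" for i
  proof -
    define e :: "real vec" where "e = unit_vec N i"
    have e: "e \<in> carrier_vec N" by (simp add: e_def)
    have Me: "M *\<^sub>v e \<in> carrier_vec c" using M e by simp
    have "a i = Yf *\<^sub>v e - (K * M) *\<^sub>v e"
      unfolding a_def e_def[symmetric] using Yf K M e by (intro minus_mult_distrib_mat_vec) auto
    also have "(K * M) *\<^sub>v e = K *\<^sub>v (M *\<^sub>v e)" using K M e by (rule assoc_mult_mat_vec)
    finally have 1: "a i = Yf *\<^sub>v e - K *\<^sub>v (M *\<^sub>v e)" .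
    have "Yf *\<^sub>v g = (Yf * P) *\<^sub>v g" using Yf P g Pg by simp
    also have "\<dots> = H *\<^sub>v mf" unfolding YfP mf using H M g by simp
    finally have 2: "Yf *\<^sub>v g = H *\<^sub>v mf" .
    have "Yf * (1\<^sub>m N - P) = Yf - H * M"
      using Yf P by (simp add: mult_minus_mat mult_one_mat YfP)
    then have "(Yf * (1\<^sub>m N - P)) *\<^sub>v e = Yf *\<^sub>v e - (H * M) *\<^sub>v e"
      using minus_mult_distrib_mat_vec[of Yf d N "H * M" e] Yf H M e by simp
    also have "(H * M) *\<^sub>v e = H *\<^sub>v (M *\<^sub>v e)" using H M e by (rule assoc_mult_mat_vec)
    finally have 3: "scenario M Yf g i = H *\<^sub>v mf + (Yf *\<^sub>v e - H *\<^sub>v (M *\<^sub>v e))"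
      using M by (simp add: scenario_def P_def[symmetric] e_def[symmetric] 2)
    have "(K - H) *\<^sub>v (mf - M *\<^sub>v e) = (K - H) *\<^sub>v mf - (K - H) *\<^sub>v (M *\<^sub>v e)"
      using K H mfc Me by (intro mult_minus_distrib_mat_vec[of _ d c]) auto
    also have "\<dots> = (K *\<^sub>v mf - H *\<^sub>v mf) - (K *\<^sub>v (M *\<^sub>v e) - H *\<^sub>v (M *\<^sub>v e))"
      using minus_mult_distrib_mat_vec[OF K H mfc] minus_mult_distrib_mat_vec[OF K H Me] by simp
    also have "\<dots> = K *\<^sub>v mf + a i - scenario M Yf g i"
      unfolding 1 3 using K H Yf by (intro eq_vecI) auto
    finally show ?thesis by (simp add: e_def)
  qed
  have step: "f (K *\<^sub>v mf + a i) \<le> f (scenario M Yf g i) + L * (e1 * nrm i)" for i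
  proof -
    have Me: "M *\<^sub>v unit_vec N i \<in> carrier_vec c" using M by simp
    have "lr_norm r (K *\<^sub>v mf + a i - scenario M Yf g i) \<le> op_norm r (K - H) * lr_norm r (mf - M *\<^sub>v unit_vec N i)"
      unfolding diff using K H mfc Me by (intro lr_norm_mult_le_op_norm[OF r, of _ d c]) auto
    also have "\<dots> = op_norm r (K - H) * nrm i"
      by (simp add: nrm_def lr_norm_minus_commute[OF mfc Me])
    also have "\<dots> \<le> e1 * nrm i"
      using e1 by (intro mult_right_mono) (auto simp: H_def nrm_def)
    finally have "L * lr_norm r (K *\<^sub>v mf + a i - scenario M Yf g i) \<le> L * (e1 * nrm i)"
      using L by simp
    moreover have "f (K *\<^sub>v mf + a i) \<le> f (scenario M Yf g i) + L * lr_norm r (K *\<^sub>v mf + a i - scenario M Yf g i)"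
      using Kmf ac sc by (intro lipschitz_vecD(1)[OF f]) auto
    ultimately show ?thesis by linarith
  qed
  \<comment> \<open>The shift by \<open>K *\<^sub>v mf\<close> is absorbed into the test function,
    so the distance enters only through the residuals \<open>a\<close>, which do not involve
    \<open>g\<close>.\<close>
  have "(\<integral>z. f (K *\<^sub>v mf + z) \<partial>Q) \<le> (1 / real N) * (\<Sum>i<N. f (K *\<^sub>v mf + a i)) + L * gap N a"
    by (rule gap_upper[OF ac N L lipschitz_vec_translate[OF f Kmf]])
  also have "\<dots> \<le> (1 / real N) * (\<Sum>i<N. f (scenario M Yf g i) + L * (e1 * nrm i)) + L * e2"
    using e2 L step by (intro add_mono mult_left_mono sum_mono) (auto simp: a_def)
  also have "\<dots> = (1 / real N) * (\<Sum>i<N. f (scenario M Yf g i)) + L * (e1 * ((1 / real N) * (\<Sum>i<N. nrm i)) + e2)"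
    by (simp add: sum.distrib sum_distrib_left[symmetric] add_divide_distrib distrib_left)
  also have "\<dots> \<le> (1 / real N) * (\<Sum>i<N. f (scenario M Yf g i))
      + L * (e1 * ((1 / real N) * (\<Sum>i<N. nrm i powr r)) powr (1 / r) + e2)"
    using L e1(2) N
    by (intro add_mono mult_left_mono order_refl mean_powr_le[OF r]) (auto simp: nrm_def)
  finally show ?thesis using M by (simp add: radius_def nrm_def)
qed

end

lemma mult_mat_vec_zero: "(X :: real mat) \<in> carrier_mat a b \<Longrightarrow> X *\<^sub>v 0\<^sub>v b = 0\<^sub>v a"
  by (intro eq_vecI) auto

text \<open>At the zero regressor the atoms are the bare residuals, the points at which the dual
  distance is evaluated.\<close>

lemma empirical_law_zero:
  assumes "K \<in> carrier_mat d c" "M \<in> carrier_mat c N" "Yf \<in> carrier_mat d N"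
  shows "empirical_law K M Yf (0\<^sub>v c)
    = distr (uniform_count_measure {..<N}) (borel_vec d) (\<lambda>i. (Yf - K * M) *\<^sub>v unit_vec N i)"
proof -
  have "0\<^sub>v d + (Yf - K * M) *\<^sub>v unit_vec N i = (Yf - K * M) *\<^sub>v unit_vec N i" for i
    using assms by (intro left_zero_vec) (auto intro!: mult_mat_vec_carrier)
  then show ?thesis
    using assms by (simp add: empirical_law_def mult_mat_vec_zero[OF assms(1)])
qed

section \<open>Measurability of the data matrices, the disturbance and the program\<close>

lemma measurable_stack:
  assumes "\<And>k. k0 \<le> k \<Longrightarrow> k < k0 + l \<Longrightarrow> measurable_vec S q (z k)"
  shows "measurable_vec S (q * l) (\<lambda>\<omega>. stack q (\<lambda>k. z k \<omega>) k0 l)"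
  unfolding measurable_vec_def
proof (intro allI impI)
  fix i assume i: "i < q * l"
  then have q: "0 < q" by (cases q) auto
  have "i div q < l" using i q by (simp add: less_mult_imp_div_less mult.commute)
  then have "measurable_vec S q (z (k0 + i div q))" by (intro assms) auto
  then show "(\<lambda>\<omega>. stack q (\<lambda>k. z k \<omega>) k0 l $ i) \<in> borel_measurable S"
    using i q by (simp add: stack_def measurable_vec_def)
qed

lemma hankel_index:
  assumes "i < q * l" "j < N"
  shows "hankel q l N z $$ (i, j) = stack q z (j + 1) l $ i"
  using assms by (simp add: hankel_def mat_of_cols_index)

text \<open>Column \<open>j\<close> of the Hankel matrix starts at time \<open>j + 1\<close>, hence
  the premise on times from 1 on.\<close>

lemma measurable_past_rows:
  assumes "\<And>k. 1 \<le> k \<Longrightarrow> measurable_vec S q (z k)"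
  shows "measurable_mat S (q * Tp) N (\<lambda>\<omega>. past_rows q Tp Tf N (\<lambda>k. z k \<omega>))"
proof (rule measurable_matI)
  fix i j assume ij: "i < q * Tp" "j < N"
  have i: "i < q * (Tp + Tf)" using ij by (simp add: algebra_simps)
  have "measurable_vec S (q * (Tp + Tf)) (\<lambda>\<omega>. stack q (\<lambda>k. z k \<omega>) (j + 1) (Tp + Tf))"
    by (intro measurable_stack assms) auto
  then show "(\<lambda>\<omega>. past_rows q Tp Tf N (\<lambda>k. z k \<omega>) $$ (i, j)) \<in> borel_measurable S"
    using i ij by (simp add: past_rows_def hankel_index measurable_vec_def)
qed (simp_all add: past_rows_def)

lemma measurable_future_rows:
  assumes "\<And>k. 1 \<le> k \<Longrightarrow> measurable_vec S q (z k)"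
  shows "measurable_mat S (q * Tf) N (\<lambda>\<omega>. future_rows q Tp Tf N (\<lambda>k. z k \<omega>))"
proof (rule measurable_matI)
  fix i j assume ij: "i < q * Tf" "j < N"
  have i: "q * Tp + i < q * (Tp + Tf)" using ij by (simp add: algebra_simps)
  have "measurable_vec S (q * (Tp + Tf)) (\<lambda>\<omega>. stack q (\<lambda>k. z k \<omega>) (j + 1) (Tp + Tf))"
    by (intro measurable_stack assms) auto
  then show "(\<lambda>\<omega>. future_rows q Tp Tf N (\<lambda>k. z k \<omega>) $$ (i, j)) \<in> borel_measurable S"
    using i ij by (simp add: future_rows_def hankel_index measurable_vec_def)
qed (simp_all add: future_rows_def)

lemma measurable_append_rows:
  assumes X: "measurable_mat S a c X" and Y: "measurable_mat S b c Y"
  shows "measurable_mat S (a + b) c (\<lambda>\<omega>. X \<omega> @\<^sub>r Y \<omega>)"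
proof (rule measurable_matI)
  fix i j assume ij: "i < a + b" "j < c"
  then show "(\<lambda>\<omega>. (X \<omega> @\<^sub>r Y \<omega>) $$ (i, j)) \<in> borel_measurable S"
    using measurable_mat_index[OF X, of i j] measurable_mat_index[OF Y, of "i - a" j]
    by (cases "i < a") (simp_all add: append_rows_def measurable_mat_dims[OF X] measurable_mat_dims[OF Y])
qed (simp_all add: append_rows_def measurable_mat_dims[OF X] measurable_mat_dims[OF Y])

lemma measurable_append_vec:
  assumes X: "measurable_vec S a X" "\<And>\<omega>. \<omega> \<in> space S \<Longrightarrow> X \<omega> \<in> carrier_vec a"
    and Y: "measurable_vec S b Y" "\<And>\<omega>. \<omega> \<in> space S \<Longrightarrow> Y \<omega> \<in> carrier_vec b"
  shows "measurable_vec S (a + b) (\<lambda>\<omega>. X \<omega> @\<^sub>v Y \<omega>)"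
  unfolding measurable_vec_def
proof (intro allI impI)
  fix i assume i: "i < a + b"
  have "(\<lambda>\<omega>. if i < a then X \<omega> $ i else Y \<omega> $ (i - a)) \<in> borel_measurable S"
    using X(1) Y(1) i by (cases "i < a") (auto simp: measurable_vec_def)
  moreover have "(X \<omega> @\<^sub>v Y \<omega>) $ i = (if i < a then X \<omega> $ i else Y \<omega> $ (i - a))" if "\<omega> \<in> space S" for \<omega>
    using X(2)[OF that] Y(2)[OF that] i by auto
  ultimately show "(\<lambda>\<omega>. (X \<omega> @\<^sub>v Y \<omega>) $ i) \<in> borel_measurable S"
    by (subst measurable_cong) auto
qed

lemma block_mat_dims [simp]:
  "dim_row (block_mat a b I J F) = a * I" "dim_col (block_mat a b I J F) = b * J"
  by (simp_all add: block_mat_def)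

lemma predictor_carrier:
  assumes "B \<in> carrier_mat n m" "C \<in> carrier_mat p n" "Oinv \<in> carrier_mat n (p * Tp)"
  shows "predictor A B C D Tp Tf Oinv \<in> carrier_mat (p * Tf) (m * Tp + p * Tp + m * Tf)"
  using assms
  by (intro carrier_matI)
    (simp_all add: predictor_def append_cols_def obs_mat_def toeplitz_u_def)

lemma measurable_disturbance:
  assumes A: "A \<in> carrier_mat n n" and C: "C \<in> carrier_mat p n"
    and w: "\<And>k. k < Tp + Tf \<Longrightarrow> measurable_vec S n (w k)"
    and v: "\<And>k. k < Tp + Tf \<Longrightarrow> measurable_vec S p (v k)"
    and Oinv: "Oinv \<in> carrier_mat n (p * Tp)"
  shows "(\<lambda>\<omega>. disturbance A C Tp Tf Oinv
      (stack n (\<lambda>k. w k \<omega>) 0 Tp) (stack p (\<lambda>k. v k \<omega>) 0 Tp)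
      (stack n (\<lambda>k. w k \<omega>) Tp Tf) (stack p (\<lambda>k. v k \<omega>) Tp Tf)) \<in> measurable S (borel_vec (p * Tf))"
proof (rule measurable_borel_vecI)
  have sc: "stack q z k l \<in> carrier_vec (q * l)" for q z k l
    by (simp add: stack_def)
  have d: "dim_row A = n" "dim_col A = n" "dim_row C = p" "dim_col C = n" using A C by auto
  let ?X = "obs_mat A C Tf * (reach_w A Tp - A ^\<^sub>m Tp * Oinv * toeplitz_w A C Tp)"
  let ?Y = "obs_mat A C Tf * A ^\<^sub>m Tp * Oinv"
  let ?Z = "toeplitz_w A C Tf"
  have X: "?X \<in> carrier_mat (p * Tf) (n * Tp)" and Y: "?Y \<in> carrier_mat (p * Tf) (p * Tp)"
    and Z: "?Z \<in> carrier_mat (p * Tf) (n * Tf)"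
    using d Oinv by (intro carrier_matI; simp add: obs_mat_def toeplitz_w_def)+
  have ms: "measurable_vec S (n * Tp) (\<lambda>\<omega>. stack n (\<lambda>k. w k \<omega>) 0 Tp)"
    "measurable_vec S (p * Tp) (\<lambda>\<omega>. stack p (\<lambda>k. v k \<omega>) 0 Tp)"
    "measurable_vec S (n * Tf) (\<lambda>\<omega>. stack n (\<lambda>k. w k \<omega>) Tp Tf)"
    "measurable_vec S (p * Tf) (\<lambda>\<omega>. stack p (\<lambda>k. v k \<omega>) Tp Tf)"
    using w v by (auto intro!: measurable_stack)
  have mX: "measurable_vec S (p * Tf) (\<lambda>\<omega>. ?X *\<^sub>v stack n (\<lambda>k. w k \<omega>) 0 Tp)"
    by (rule measurable_mult_mat_vec[OF measurable_mat_const[OF X] ms(1) sc])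
  have mY: "measurable_vec S (p * Tf) (\<lambda>\<omega>. ?Y *\<^sub>v stack p (\<lambda>k. v k \<omega>) 0 Tp)"
    by (rule measurable_mult_mat_vec[OF measurable_mat_const[OF Y] ms(2) sc])
  have mZ: "measurable_vec S (p * Tf) (\<lambda>\<omega>. ?Z *\<^sub>v stack n (\<lambda>k. w k \<omega>) Tp Tf)"
    by (rule measurable_mult_mat_vec[OF measurable_mat_const[OF Z] ms(3) sc])
  show "measurable_vec S (p * Tf) (\<lambda>\<omega>. disturbance A C Tp Tf Oinv
      (stack n (\<lambda>k. w k \<omega>) 0 Tp) (stack p (\<lambda>k. v k \<omega>) 0 Tp)
      (stack n (\<lambda>k. w k \<omega>) Tp Tf) (stack p (\<lambda>k. v k \<omega>) Tp Tf))"
    unfolding disturbance_def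
    using Y Z by (intro measurable_vec_add measurable_vec_minus mX mY mZ ms(4) sc) (auto intro!: mult_mat_vec_carrier sc)
  show "disturbance A C Tp Tf Oinv
      (stack n (\<lambda>k. w k \<omega>) 0 Tp) (stack p (\<lambda>k. v k \<omega>) 0 Tp)
      (stack n (\<lambda>k. w k \<omega>) Tp Tf) (stack p (\<lambda>k. v k \<omega>) Tp Tf) \<in> carrier_vec (p * Tf)" for \<omega>
    by (intro carrier_vecI) (simp add: disturbance_def stack_def)
qed

text \<open>A push-forward keeps mass 1 when the map is measurable; here the noise pairs are the
  coordinate projections of the product space.\<close>

lemma prob_space_disturbance_law:
  assumes A: "A \<in> carrier_mat n n" and C: "C \<in> carrier_mat p n" and Oinv: "Oinv \<in> carrier_mat n (p * Tp)"
    and P: "prob_space Pwv" and sets_P: "sets Pwv = sets (borel_vec n \<Otimes>\<^sub>M borel_vec p)"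
  shows "prob_space (disturbance_law A C Tp Tf Oinv Pwv)"
proof -
  let ?S = "\<Pi>\<^sub>M k\<in>{..<Tp + Tf}. Pwv"
  have *: "(\<lambda>z. z k) \<in> measurable ?S (borel_vec n \<Otimes>\<^sub>M borel_vec p)" if "k < Tp + Tf" for k
    using that by (subst measurable_cong_sets[OF refl sets_P[symmetric]]) (auto intro: measurable_component_singleton)
  have w: "measurable_vec ?S n (\<lambda>z. fst (z k))" if "k < Tp + Tf" for k
    by (rule measurable_borel_vecD(1)) (rule measurable_compose[OF *[OF that] measurable_fst])
  have v: "measurable_vec ?S p (\<lambda>z. snd (z k))" if "k < Tp + Tf" for k
    by (rule measurable_borel_vecD(1)) (rule measurable_compose[OF *[OF that] measurable_snd])
  have "prob_space ?S" by (intro prob_space_PiM P)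
  then show ?thesis
    unfolding disturbance_law_def
    using A C measurable_disturbance[OF A C w v Oinv] by (intro prob_space.prob_space_distr) auto
qed

text \<open>Here the measurable dependence of the pseudoinverse on the data enters.\<close>

lemma measurable_scenario:
  assumes M: "measurable_mat S c N M" and Y: "measurable_mat S d N Y"
    and g: "measurable_vec S N g" "\<And>\<omega>. \<omega> \<in> space S \<Longrightarrow> g \<omega> \<in> carrier_vec N"
  shows "measurable_vec S d (\<lambda>\<omega>. scenario (M \<omega>) (Y \<omega>) (g \<omega>) i)"
    and scenario_carrier: "scenario (M \<omega>) (Y \<omega>) (g \<omega>) i \<in> carrier_vec d"
proof -
  have N: "dim_col (M \<omega>) = N" for \<omega> using measurable_mat_dims[OF M] by simp
  have P: "measurable_mat S N N (\<lambda>\<omega>. 1\<^sub>m N - pinv (M \<omega>) * M \<omega>)"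
    by (rule measurable_mat_diff[OF measurable_mat_const[OF one_carrier_mat] measurable_mat_mult[OF measurable_pinv[OF M] M]])
  have "measurable_vec S d (\<lambda>\<omega>. (Y \<omega> * (1\<^sub>m N - pinv (M \<omega>) * M \<omega>)) *\<^sub>v unit_vec N i)"
    by (rule measurable_mult_mat_vec[OF measurable_mat_mult[OF Y P] measurable_vec_const unit_vec_carrier])
  then show "measurable_vec S d (\<lambda>\<omega>. scenario (M \<omega>) (Y \<omega>) (g \<omega>) i)"
    unfolding scenario_def N
    by (intro measurable_vec_add measurable_mult_mat_vec[OF Y g]) (auto intro!: carrier_vecI simp: measurable_mat_dims[OF Y])
  show "scenario (M \<omega>) (Y \<omega>) (g \<omega>) i \<in> carrier_vec d"
    by (intro carrier_vecI) (simp add: scenario_def measurable_mat_dims[OF Y])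
qed

lemma measurable_radius:
  assumes r: "1 \<le> r" and M: "measurable_mat S c N M"
    and mf: "measurable_vec S c mf" "\<And>\<omega>. \<omega> \<in> space S \<Longrightarrow> mf \<omega> \<in> carrier_vec c"
  shows "(\<lambda>\<omega>. radius r e1 e2 (M \<omega>) (mf \<omega>)) \<in> borel_measurable S"
proof -
  have N: "dim_col (M \<omega>) = N" for \<omega> using measurable_mat_dims[OF M] by simp
  have [measurable]: "(\<lambda>\<omega>. lr_norm r (M \<omega> *\<^sub>v unit_vec N i - mf \<omega>)) \<in> borel_measurable S" for i
    by (rule measurable_lipschitz_vec[OF r lipschitz_lr_norm[OF r]])
      (use mf in \<open>auto intro!: measurable_vec_minus measurable_mult_mat_vec[OF M measurable_vec_const unit_vec_carrier]
          minus_carrier_vec carrier_vecI simp: measurable_mat_dims[OF M]\<close>)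
  show ?thesis unfolding radius_def N by measurable
qed

lemma measurable_program_mean:
  assumes "1 \<le> r" "lipschitz_vec r d L f"
    and M: "measurable_mat S c N M" and Y: "measurable_mat S d N Y"
    and g: "measurable_vec S N g" "\<And>\<omega>. \<omega> \<in> space S \<Longrightarrow> g \<omega> \<in> carrier_vec N"
  shows "(\<lambda>\<omega>. (1 / real N) * (\<Sum>i<N. f (scenario (M \<omega>) (Y \<omega>) (g \<omega>) i))) \<in> borel_measurable S"
proof -
  have [measurable]: "(\<lambda>\<omega>. f (scenario (M \<omega>) (Y \<omega>) (g \<omega>) i)) \<in> borel_measurable S" for i
    by (rule measurable_lipschitz_vec[OF assms(1,2) measurable_scenario[OF M Y g]])
      (auto intro: scenario_carrier[OF M Y g])
  show ?thesis by measurable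
qed

lemma rate_pos: "0 < C0 \<Longrightarrow> 1 \<le> N \<Longrightarrow> 0 < rate C0 r q d N"
  by (auto simp: rate_def intro!: mult_pos_pos add_pos_pos add_nonneg_pos mult_nonneg_nonneg)

lemma (in prob_space) prob_Int_ge:
  assumes "A \<in> events" "B \<in> events" "1 - a \<le> prob A" "1 - b \<le> prob B"
  shows "1 - (a + b) \<le> prob (A \<inter> B)"
proof -
  have "prob (A \<union> B) + prob (A \<inter> B) = prob A + prob B"
    using assms(1,2) by (simp add: measure_Un3 fmeasurable_eq_sets)
  then show ?thesis using prob_le_1[of "A \<union> B"] assms by linarith
qed

lemma measurable_vec_cong:
  assumes "\<And>\<omega>. \<omega> \<in> space S \<Longrightarrow> X \<omega> = Y \<omega>" "measurable_vec S d Y"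
  shows "measurable_vec S d X"
  using assms(2) unfolding measurable_vec_def
  by (auto cong: measurable_cong simp: assms(1))

text \<open>Serves the state recursion and the output equation alike.\<close>

lemma measurable_affine_step:
  assumes A: "A \<in> carrier_mat a b" and B: "B \<in> carrier_mat a c"
    and X: "measurable_vec S b X" "\<And>\<omega>. \<omega> \<in> space S \<Longrightarrow> X \<omega> \<in> carrier_vec b"
    and U: "measurable_vec S c U" "\<And>\<omega>. \<omega> \<in> space S \<Longrightarrow> U \<omega> \<in> carrier_vec c"
    and W: "measurable_vec S a W" "\<And>\<omega>. \<omega> \<in> space S \<Longrightarrow> W \<omega> \<in> carrier_vec a"
  shows "measurable_vec S a (\<lambda>\<omega>. A *\<^sub>v X \<omega> + B *\<^sub>v U \<omega> + W \<omega>)"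
proof -
  have AX: "measurable_vec S a (\<lambda>\<omega>. A *\<^sub>v X \<omega>)"
    by (rule measurable_mult_mat_vec[OF measurable_mat_const[OF A] X])
  have BU: "measurable_vec S a (\<lambda>\<omega>. B *\<^sub>v U \<omega>)"
    by (rule measurable_mult_mat_vec[OF measurable_mat_const[OF B] U])
  have BU_carrier: "B *\<^sub>v U \<omega> \<in> carrier_vec a" for \<omega>
    using B by (intro carrier_vecI) simp
  show ?thesis by (rule measurable_vec_add[OF measurable_vec_add[OF AX BU BU_carrier] W])
qed

section \<open>The good event and its consequences for cost and risk\<close>

theorem theorem3:
  fixes A B C D Oinv K :: "real mat"
    and n m p Tp Tf T N :: nat
    and Pr :: "'w measure"
    and Pw Pv Pxi :: "real vec measure"
    and Pwv :: "(real vec \<times> real vec) measure"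
    and x u y w v :: "nat \<Rightarrow> 'w \<Rightarrow> real vec"
    and Up Yp Uf Yf M Khat :: "nat \<Rightarrow> 'w \<Rightarrow> real mat"
    and r q \<alpha> \<beta> Lobj Lcon C0 \<epsilon>\<^sub>1 \<epsilon>\<^sub>2 :: real
    and \<gamma> :: "real \<Rightarrow> real"
    and f1 f2 h :: "real vec \<Rightarrow> real"
    and \<U> :: "real vec set"
    and up yp :: "real vec"
    and g mf :: "'w \<Rightarrow> real vec"
    and \<epsilon> J Jhat :: "'w \<Rightarrow> real"
  assumes "A \<in> carrier_mat n n" "B \<in> carrier_mat n m" "C \<in> carrier_mat p n" "D \<in> carrier_mat p m"
    and "1 \<le> Tp" "1 \<le> Tf"
    and observable: "observable A C" "n \<le> Tp"
    and "Oinv \<in> carrier_mat n (p * Tp)" "Oinv * obs_mat A C Tp = 1\<^sub>m n"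
    and K_def: "K = predictor A B C D Tp Tf Oinv"
    and Pxi_def: "Pxi = disturbance_law A C Tp Tf Oinv Pwv"
    and "prob_space Pr"
    and "x 1 \<in> measurable Pr (borel_vec n)"
    and "\<And>k. 1 \<le> k \<Longrightarrow> u k \<in> measurable Pr (borel_vec m)"
    and "prob_space.indep_vars Pr (\<lambda>_. borel_vec n \<Otimes>\<^sub>M borel_vec p) (\<lambda>k \<omega>. (w k \<omega>, v k \<omega>)) {1..}"
    and "\<And>k. 1 \<le> k \<Longrightarrow> distr Pr (borel_vec n \<Otimes>\<^sub>M borel_vec p) (\<lambda>\<omega>. (w k \<omega>, v k \<omega>)) = Pwv"
    and "\<And>k. 1 \<le> k \<Longrightarrow> distr Pr (borel_vec n) (w k) = Pw"
    and "\<And>k. 1 \<le> k \<Longrightarrow> distr Pr (borel_vec p) (v k) = Pv"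
    and "\<And>k \<omega>. 1 \<le> k \<Longrightarrow> \<omega> \<in> space Pr \<Longrightarrow>
           x (Suc k) \<omega> = A *\<^sub>v x k \<omega> + B *\<^sub>v u k \<omega> + w k \<omega>"
    and "\<And>k \<omega>. 1 \<le> k \<Longrightarrow> \<omega> \<in> space Pr \<Longrightarrow>
           y k \<omega> = C *\<^sub>v x k \<omega> + D *\<^sub>v u k \<omega> + v k \<omega>"
    and T: "Tp + Tf \<le> T" "N = T - (Tp + Tf) + 1"
    and Up_def: "Up = (\<lambda>N \<omega>. past_rows m Tp Tf N (\<lambda>k. u k \<omega>))"
    and Yp_def: "Yp = (\<lambda>N \<omega>. past_rows p Tp Tf N (\<lambda>k. y k \<omega>))"
    and Uf_def: "Uf = (\<lambda>N \<omega>. future_rows m Tp Tf N (\<lambda>k. u k \<omega>))"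
    and Yf_def: "Yf = (\<lambda>N \<omega>. future_rows p Tp Tf N (\<lambda>k. y k \<omega>))"
    and M_def: "M = (\<lambda>N \<omega>. Up N \<omega> @\<^sub>r Yp N \<omega> @\<^sub>r Uf N \<omega>)"
    and Khat_def: "Khat = (\<lambda>N \<omega>. Yf N \<omega> * pinv (M N \<omega>))"
    and "1 \<le> r"
    and "\<And>\<alpha>'. \<alpha>' \<in> {0<..<1} \<Longrightarrow> 0 < \<gamma> \<alpha>'"
    and gamma: "\<And>\<alpha>'. \<alpha>' \<in> {0<..<1} \<Longrightarrow>
           measure Pr {\<omega> \<in> space Pr. op_norm r (K - Khat N \<omega>) \<le> \<gamma> \<alpha>'} \<ge> 1 - \<alpha>'"
    and moment: "r < q" "\<And>\<mu>. \<mu> \<in> carrier_vec (m * Tp + p * Tp + m * Tf) \<Longrightarrow>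
           (\<integral>\<^sup>+ z. ennreal (lr_norm r z powr q) \<partial>output_law K Pxi \<mu>) < \<infinity>"
    and "0 < Lobj" "0 < Lcon"
    and "convex_vec (p * Tf) f2" "lipschitz_vec r (p * Tf) Lobj f2"
    and "convex_vec (p * Tf) h" "lipschitz_vec r (p * Tf) Lcon h"
    and "0 < C0"
    and concentration: "\<And>N' \<mu>. 1 \<le> N' \<Longrightarrow> \<mu> \<in> carrier_vec (m * Tp + p * Tp + m * Tf) \<Longrightarrow>
           (\<integral>\<^sup>+ \<omega>. ennpowr (wasserstein r (empirical_law K (M N' \<omega>) (Yf N' \<omega>) \<mu>) (output_law K Pxi \<mu>)) r \<partial>Pr)
           \<le> ennreal (rate C0 r q (p * Tf) N')"
    and "\<alpha> \<in> {0<..<1}" "\<beta> \<in> {0<..<1}"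
    and "\<U> \<subseteq> carrier_vec (m * Tf)"
    and "up \<in> carrier_vec (m * Tp)" "yp \<in> carrier_vec (p * Tp)"
    and eps1_def: "\<epsilon>\<^sub>1 = \<gamma> (\<alpha> / 2)"
    and eps2_def: "\<epsilon>\<^sub>2 = (2 * rate C0 r q (p * Tf) N / \<alpha>) powr (1 / r)"
    and g: "g \<in> measurable Pr (borel_vec N)"
    and mf_def: "mf = (\<lambda>\<omega>. up @\<^sub>v yp @\<^sub>v (Uf N \<omega> *\<^sub>v g \<omega>))"
    and eps_def: "\<epsilon> = (\<lambda>\<omega>. radius r \<epsilon>\<^sub>1 \<epsilon>\<^sub>2 (M N \<omega>) (mf \<omega>))"
    and feasible: "AE \<omega> in Pr. \<exists>\<tau> s. program_feasible h \<U> \<beta> Lcon (\<epsilon> \<omega>) up yp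
           (M N \<omega>) (Up N \<omega>) (Yp N \<omega>) (Uf N \<omega>) (Yf N \<omega>) (g \<omega>) \<tau> s"
    and Jhat_def: "Jhat = (\<lambda>\<omega>. program_cost f1 f2 Lobj (\<epsilon> \<omega>) (M N \<omega>) (Uf N \<omega>) (Yf N \<omega>) (g \<omega>))"
    and J_def: "J = (\<lambda>\<omega>. \<integral>z. f1 (Uf N \<omega> *\<^sub>v g \<omega>) + f2 z \<partial>output_law K Pxi (mf \<omega>))"
  shows "measure Pr {\<omega> \<in> space Pr. J \<omega> \<le> Jhat \<omega>} \<ge> 1 - \<alpha>
       \<and> measure Pr {\<omega> \<in> space Pr. cvar (output_law K Pxi (mf \<omega>)) \<beta> h \<le> 0} \<ge> 1 - \<alpha>"
  proof -
  interpret Pr: prob_space Pr by (rule assms(13))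
  define d c where "d = p * Tf" and "c = m * Tp + p * Tp + m * Tf"
  have r: "1 \<le> r" by (rule assms(30))
  have N: "1 \<le> N" using T by simp
  have K: "K \<in> carrier_mat d c"
    unfolding K_def d_def c_def by (rule predictor_carrier[OF assms(2,3,9)])
  have A: "A \<in> carrier_mat n n" and C: "C \<in> carrier_mat p n"
    and B: "B \<in> carrier_mat n m" and D: "D \<in> carrier_mat p m"
    by fact+

  \<comment> \<open>Measurability of the noise pairs is part of their independence.\<close>
  have wv: "(\<lambda>\<omega>. (w k \<omega>, v k \<omega>)) \<in> measurable Pr (borel_vec n \<Otimes>\<^sub>M borel_vec p)" if "1 \<le> k" for k
    using assms(16) that by (auto simp: Pr.indep_vars_def2)
  have w: "w k \<in> measurable Pr (borel_vec n)" and v: "v k \<in> measurable Pr (borel_vec p)" if "1 \<le> k" for k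
    using measurable_compose[OF wv[OF that] measurable_fst] measurable_compose[OF wv[OF that] measurable_snd]
    by simp_all
  note w' = measurable_borel_vecD[OF w] and v' = measurable_borel_vecD[OF v]
    and u' = measurable_borel_vecD[OF assms(15)]
  have x: "measurable_vec Pr n (x k) \<and> (\<forall>\<omega>\<in>space Pr. x k \<omega> \<in> carrier_vec n)" if "1 \<le> k" for k
    using that
  proof (induction k rule: nat_induct_at_least)
    case base
    then show ?case using measurable_borel_vecD[OF assms(14)] by auto
  next
    case (Suc k)
    have "measurable_vec Pr n (\<lambda>\<omega>. A *\<^sub>v x k \<omega> + B *\<^sub>v u k \<omega> + w k \<omega>)"
      using Suc(2) by (intro measurable_affine_step[OF A B _ _ u'[OF Suc(1)] w'[OF Suc(1)]]) auto
    then have "measurable_vec Pr n (x (Suc k))"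
      by (rule measurable_vec_cong[rotated]) (rule assms(20)[OF Suc(1)])
    moreover have "x (Suc k) \<omega> \<in> carrier_vec n" if "\<omega> \<in> space Pr" for \<omega>
      \<comment> \<open>The dimension of a sum of vectors is that of its last summand, here the
        noise.\<close>
      using carrier_vecD[OF w'(2)[OF Suc(1) that]] by (intro carrier_vecI) (simp add: assms(20)[OF Suc(1) that])
    ultimately show ?case by blast
  qed
  have y: "measurable_vec Pr p (y k)" if k: "1 \<le> k" for k
  proof -
    have "measurable_vec Pr p (\<lambda>\<omega>. C *\<^sub>v x k \<omega> + D *\<^sub>v u k \<omega> + v k \<omega>)"
      using x[OF k] by (intro measurable_affine_step[OF C D _ _ u'[OF k] v'[OF k]]) auto
    then show ?thesis
      by (rule measurable_vec_cong[rotated]) (rule assms(21)[OF k])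
  qed
  have Up: "measurable_mat Pr (m * Tp) N (Up N)" and Yp: "measurable_mat Pr (p * Tp) N (Yp N)"
    and Uf: "measurable_mat Pr (m * Tf) N (Uf N)" and Yf: "measurable_mat Pr d N (Yf N)"
    using u' y unfolding Up_def Yp_def Uf_def Yf_def d_def
    by (auto intro!: measurable_past_rows measurable_future_rows)
  have M: "measurable_mat Pr c N (M N)"
    using measurable_append_rows[OF Up measurable_append_rows[OF Yp Uf]]
    by (simp add: M_def c_def add.assoc)
  have carrier: "M N \<omega> \<in> carrier_mat c N" "Up N \<omega> \<in> carrier_mat (m * Tp) N" "Yp N \<omega> \<in> carrier_mat (p * Tp) N"
    "Uf N \<omega> \<in> carrier_mat (m * Tf) N" "Yf N \<omega> \<in> carrier_mat d N" for \<omega>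
    using M Up Yp Uf Yf by (simp_all add: measurable_mat_def)
  have dim_M: "dim_col (M N \<omega>) = N" for \<omega> using carrier(1)[of \<omega>] by simp
  note g' = measurable_borel_vecD[OF g]
  have up: "up \<in> carrier_vec (m * Tp)" and yp: "yp \<in> carrier_vec (p * Tp)"
    using assms(46,47) .
  have Ufg: "Uf N \<omega> *\<^sub>v g \<omega> \<in> carrier_vec (m * Tf)" if "\<omega> \<in> space Pr" for \<omega>
    using carrier(4) g'(2)[OF that] by (rule mult_mat_vec_carrier)
  have mf: "measurable_vec Pr c mf"
    unfolding mf_def c_def add.assoc
    using up yp Ufg
    by (intro measurable_append_vec measurable_vec_const measurable_mult_mat_vec[OF Uf g']) auto
  have mf_carrier: "mf \<omega> \<in> carrier_vec c" if "\<omega> \<in> space Pr" for \<omega>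
    using carrier_vecD[OF up] carrier_vecD[OF yp] carrier_vecD[OF Ufg[OF that]]
    by (intro carrier_vecI) (simp add: mf_def c_def del: dim_mult_mat_vec)
  have Kmf_carrier: "K *\<^sub>v \<mu> \<in> carrier_vec d" for \<mu>
    using K by (intro carrier_vecI) simp
  have Kmf: "measurable_vec Pr d (\<lambda>\<omega>. K *\<^sub>v mf \<omega>)"
    by (rule measurable_mult_mat_vec[OF measurable_mat_const[OF K] mf mf_carrier])

  have sets_Pwv: "sets Pwv = sets (borel_vec n \<Otimes>\<^sub>M borel_vec p)"
    using assms(17)[of 1] by (metis le_refl sets_distr)
  have "prob_space Pwv"
    using Pr.prob_space_distr[OF wv, of 1] assms(17)[of 1] by simp
  then have prob_Pxi: "prob_space Pxi"
    unfolding Pxi_def by (rule prob_space_disturbance_law[OF A C assms(9) _ sets_Pwv])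
  have sets_Pxi: "sets Pxi = sets (borel_vec d)"
    using C by (simp add: Pxi_def disturbance_law_def d_def)
  then have space_Pxi: "space Pxi = carrier_vec d"
    using sets_eq_imp_space_eq[OF sets_Pxi] by simp
  have id_Pxi: "(\<lambda>\<xi>. \<xi>) \<in> measurable Pxi (borel_vec d)"
    by (simp add: measurable_cong_sets[OF sets_Pxi refl] measurable_ident_sets)
  have shift: "(\<lambda>\<xi>. K *\<^sub>v \<mu> + \<xi>) \<in> measurable Pxi (borel_vec d)" for \<mu>
    using measurable_borel_vecD[OF id_Pxi] Kmf_carrier[of \<mu>]
    by (intro measurable_borel_vecI measurable_vec_add measurable_vec_const) auto
  have law: "(\<integral>z. f z \<partial>output_law K Pxi \<mu>) = (\<integral>z. f (K *\<^sub>v \<mu> + z) \<partial>Pxi)"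
    if "f \<in> borel_measurable (borel_vec d)" for f :: "real vec \<Rightarrow> real" and \<mu>
    using K that shift[of \<mu>] by (simp add: output_law_def integral_distr)
  have law_0: "output_law K Pxi (0\<^sub>v c) = Pxi"
  proof -
    have "output_law K Pxi (0\<^sub>v c) = distr Pxi (borel_vec d) (\<lambda>\<xi>. \<xi>)"
      using K unfolding output_law_def mult_mat_vec_zero[OF K]
      by (intro distr_cong) (auto simp: space_Pxi)
    also have "\<dots> = Pxi" by (rule distr_id2[OF sets_Pxi[symmetric]])
    finally show ?thesis .
  qed
  have norm_meas: "lr_norm r \<in> borel_measurable Pxi"
    using borel_measurable_lipschitz_vec[OF r lipschitz_lr_norm[OF r], of d]
    by (simp add: measurable_cong_sets[OF sets_Pxi refl])
  have int_q: "integrable Pxi (\<lambda>z. lr_norm r z powr q)"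
    using norm_meas assms(34)[of "0\<^sub>v c"] by (intro integrableI_nonneg) (auto simp: law_0 c_def[symmetric])
  \<comment> \<open>As \<open>q\<close> exceeds 1, the norm is dominated by 1 plus its
    \<open>q\<close>-th power; the moment hypothesis is read at the zero regressor, where the output
    law is \<open>Pxi\<close>.\<close>
  have int_norm: "integrable Pxi (lr_norm r)"
  proof (rule Bochner_Integration.integrable_bound)
    interpret P: prob_space Pxi by (rule prob_Pxi)
    show "integrable Pxi (\<lambda>z. 1 + lr_norm r z powr q)" using int_q by simp
    show "AE z in Pxi. norm (lr_norm r z) \<le> norm (1 + lr_norm r z powr q)"
    proof (rule AE_I2)
      fix z
      show "norm (lr_norm r z) \<le> norm (1 + lr_norm r z powr q)"
      proof (cases "lr_norm r z \<le> 1")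
        case False
        then have "lr_norm r z powr 1 \<le> lr_norm r z powr q"
          using r assms(33) by (intro powr_mono) auto
        then show ?thesis using False by simp
      qed (simp add: add_increasing2)
    qed
  qed (rule norm_meas)
  interpret Q: first_moment_law Pxi r d
    using prob_Pxi r sets_Pxi int_norm by (simp add: first_moment_law_def first_moment_law_axioms_def)

  define a where "a = (\<lambda>i \<omega>. (Yf N \<omega> - K * M N \<omega>) *\<^sub>v unit_vec N i)"
  have a_mat: "measurable_mat Pr d N (\<lambda>\<omega>. Yf N \<omega> - K * M N \<omega>)"
    by (rule measurable_mat_diff[OF Yf measurable_mat_mult[OF measurable_mat_const[OF K] M]])
  have a_meas: "measurable_vec Pr d (a i)" for i
    unfolding a_def by (rule measurable_mult_mat_vec[OF a_mat measurable_vec_const unit_vec_carrier])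
  have a_carrier: "a i \<omega> \<in> carrier_vec d" for i \<omega>
    unfolding a_def by (intro carrier_vecI) (simp add: measurable_mat_dims[OF a_mat] del: index_minus_mat)
  define G where "G = (\<lambda>\<omega>. Q.gap N (\<lambda>i. a i \<omega>))"
  have G: "G \<in> borel_measurable Pr"
    unfolding G_def by (intro Q.measurable_gap N a_meas a_carrier)
  have G_nonneg: "0 \<le> G \<omega>" for \<omega>
    unfolding G_def by (intro Q.gap_nonneg a_carrier N)
  define \<Gamma> where "\<Gamma> = rate C0 r q (p * Tf) N"
  have \<Gamma>: "0 < \<Gamma>" unfolding \<Gamma>_def using assms(41) N by (rule rate_pos)
  have "ennreal (G \<omega> powr r)
      \<le> ennpowr (wasserstein r (empirical_law K (M N \<omega>) (Yf N \<omega>) (0\<^sub>v c)) (output_law K Pxi (0\<^sub>v c))) r" for \<omega>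
    unfolding empirical_law_zero[OF K carrier(1,5)] law_0 G_def a_def[symmetric]
    using Q.gap_le_wasserstein[OF N, of "\<lambda>i. a i \<omega>"] a_carrier by (simp add: a_def)
  then have "(\<integral>\<^sup>+ \<omega>. ennreal (G \<omega> powr r) \<partial>Pr)
      \<le> (\<integral>\<^sup>+ \<omega>. ennpowr (wasserstein r (empirical_law K (M N \<omega>) (Yf N \<omega>) (0\<^sub>v c)) (output_law K Pxi (0\<^sub>v c))) r \<partial>Pr)"
    by (intro nn_integral_mono)
  also have "\<dots> \<le> ennreal \<Gamma>"
    unfolding \<Gamma>_def by (rule concentration[OF N]) (simp add: c_def)
  finally have EG: "(\<integral>\<^sup>+ \<omega>. ennreal (G \<omega> powr r) \<partial>Pr) \<le> ennreal \<Gamma>" .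

  have \<alpha>: "0 < \<alpha>" "\<alpha> < 1" using assms(43) by auto
  have \<beta>: "0 < \<beta>" "\<beta> < 1" using assms(44) by auto
  define E1 where "E1 = {\<omega> \<in> space Pr. op_norm r (K - Khat N \<omega>) \<le> \<epsilon>\<^sub>1}"
  \<comment> \<open>The threshold is the \<open>r\<close>-th power of
    \<open>\<epsilon>\<^sub>2\<close>, and the strict inequality makes the complement exactly the
    event in Markov's inequality.\<close>
  define E2 where "E2 = {\<omega> \<in> space Pr. G \<omega> powr r < 2 * \<Gamma> / \<alpha>}"
  have e1: "0 \<le> \<epsilon>\<^sub>1" using assms(31)[of "\<alpha> / 2"] \<alpha> by (simp add: eps1_def)
  have E1: "1 - \<alpha> / 2 \<le> Pr.prob E1"
    using gamma[of "\<alpha> / 2"] \<alpha> by (simp add: E1_def eps1_def)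
  \<comment> \<open>Measurability of \<open>E1\<close> comes from its probability: a non-measurable
    set would have measure 0, contradicting the confidence bound.\<close>
  then have "Pr.prob E1 \<noteq> 0" using \<alpha> by auto
  then have E1_sets: "E1 \<in> Pr.events" using measure_notin_sets by blast
  have E2_sets: "E2 \<in> Pr.events" using G unfolding E2_def by measurable
  have E2: "1 - \<alpha> / 2 \<le> Pr.prob E2"
  proof -
    have pos: "0 < 2 * \<Gamma> / \<alpha>" using \<Gamma> \<alpha> by simp
    have int: "integrable Pr (\<lambda>\<omega>. G \<omega> powr r)"
      using G EG by (intro integrableI_nonneg) (auto simp: order_le_less_trans less_top)
    have "ennreal (Pr.expectation (\<lambda>\<omega>. G \<omega> powr r)) \<le> ennreal \<Gamma>"
      using EG int by (subst (asm) nn_integral_eq_integral) auto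
    then have exp: "Pr.expectation (\<lambda>\<omega>. G \<omega> powr r) \<le> \<Gamma>" using \<Gamma> by simp
    have "Pr.prob {\<omega> \<in> space Pr. 2 * \<Gamma> / \<alpha> \<le> G \<omega> powr r} \<le> Pr.expectation (\<lambda>\<omega>. G \<omega> powr r) / (2 * \<Gamma> / \<alpha>)"
      by (rule integral_Markov_inequality_measure[OF int _ _ pos]) auto
    also have "\<dots> \<le> \<Gamma> / (2 * \<Gamma> / \<alpha>)"
      using exp pos by (intro divide_right_mono) auto
    also have "\<dots> = \<alpha> / 2" using \<Gamma> by simp
    finally have "Pr.prob {\<omega> \<in> space Pr. 2 * \<Gamma> / \<alpha> \<le> G \<omega> powr r} \<le> \<alpha> / 2" .
    moreover have "{\<omega> \<in> space Pr. 2 * \<Gamma> / \<alpha> \<le> G \<omega> powr r} = space Pr - E2"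
      by (auto simp: E2_def)
    ultimately show ?thesis using Pr.prob_compl[OF E2_sets] by simp
  qed
  have good: "1 - \<alpha> \<le> Pr.prob (E1 \<inter> E2)"
    using Pr.prob_Int_ge[OF E1_sets E2_sets E1 E2] by simp

  have bound: "(\<integral>z. f (K *\<^sub>v mf \<omega> + z) \<partial>Pxi)
      \<le> (1 / real N) * (\<Sum>i<N. f (scenario (M N \<omega>) (Yf N \<omega>) (g \<omega>) i)) + L * \<epsilon> \<omega>"
    if \<omega>: "\<omega> \<in> E1 \<inter> E2"
      and feas: "program_feasible h \<U> \<beta> Lcon (\<epsilon> \<omega>) up yp (M N \<omega>) (Up N \<omega>) (Yp N \<omega>) (Uf N \<omega>) (Yf N \<omega>) (g \<omega>) \<tau> s"
      and f: "0 < L" "lipschitz_vec r d L f" for \<omega> \<tau> s f L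
  proof -
    have g_facts: "g \<omega> \<in> carrier_vec N" "Up N \<omega> *\<^sub>v g \<omega> = up" "Yp N \<omega> *\<^sub>v g \<omega> = yp"
      "(1\<^sub>m N - pinv (M N \<omega>) * M N \<omega>) *\<^sub>v g \<omega> = 0\<^sub>v N"
      using feas by (simp_all add: program_feasible_def Let_def dim_M)
    \<comment> \<open>The equality constraints turn the given past \<open>up\<close>,
      \<open>yp\<close> into the first two blocks of \<open>M g\<close>, so \<open>mf\<close> lies
      in the column space of \<open>M\<close>.\<close>
    have mf_eq: "mf \<omega> = M N \<omega> *\<^sub>v g \<omega>"
      unfolding mf_def M_def
      using mat_mult_append[OF carrier(2) carrier_append_rows[OF carrier(3,4)] g_facts(1)]
        mat_mult_append[OF carrier(3,4) g_facts(1)] g_facts(2,3) by simp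
    have "G \<omega> = (G \<omega> powr r) powr (1 / r)" using G_nonneg r by (simp add: powr_powr)
    also have "\<dots> \<le> \<epsilon>\<^sub>2"
      unfolding eps2_def \<Gamma>_def[symmetric] using \<omega> r by (intro powr_mono2) (auto simp: E2_def)
    finally have "Q.gap N (\<lambda>i. (Yf N \<omega> - K * M N \<omega>) *\<^sub>v unit_vec N i) \<le> \<epsilon>\<^sub>2"
      by (simp add: G_def a_def)
    moreover have "op_norm r (K - Yf N \<omega> * pinv (M N \<omega>)) \<le> \<epsilon>\<^sub>1"
      using \<omega> by (simp add: E1_def Khat_def)
    ultimately show ?thesis
      unfolding eps_def
      by (intro Q.expectation_le_scenario_mean[OF carrier(1,5) K N g_facts(1,4) mf_eq _ e1 _ f])
  qed

  have eps_meas: "\<epsilon> \<in> borel_measurable Pr"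
    unfolding eps_def by (rule measurable_radius[OF r M mf mf_carrier])
  have f2: "lipschitz_vec r d Lobj f2" and h: "lipschitz_vec r d Lcon h"
    using assms(38,40) by (simp_all add: d_def)
  have f2_mean: "(\<lambda>\<omega>. (1 / real N) * (\<Sum>i<N. f2 (scenario (M N \<omega>) (Yf N \<omega>) (g \<omega>) i))) \<in> borel_measurable Pr"
    by (rule measurable_program_mean[OF r f2 M Yf g'])
  have J_eq: "J \<omega> = f1 (Uf N \<omega> *\<^sub>v g \<omega>) + (\<integral>z. f2 (K *\<^sub>v mf \<omega> + z) \<partial>Pxi)" for \<omega>
  proof -
    have "J \<omega> = (\<integral>z. f1 (Uf N \<omega> *\<^sub>v g \<omega>) + f2 (K *\<^sub>v mf \<omega> + z) \<partial>Pxi)"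
      unfolding J_def using borel_measurable_lipschitz_vec[OF r f2] by (intro law) simp
    then show ?thesis
      using Q.integrable_lipschitz[OF lipschitz_vec_translate[OF f2 Kmf_carrier]] by (simp add: Q.prob_space)
  qed
  have EJ_meas: "(\<lambda>\<omega>. \<integral>z. f2 (K *\<^sub>v mf \<omega> + z) \<partial>Pxi) \<in> borel_measurable Pr"
    by (rule measurable_lipschitz_vec[OF r Q.lipschitz_expectation_translate[OF f2] Kmf Kmf_carrier])
  \<comment> \<open>The value of \<open>f1\<close> occurs on both sides and cancels, so the event is
    measurable for an arbitrary \<open>f1\<close>.\<close>
  have J_set: "{\<omega> \<in> space Pr. J \<omega> \<le> Jhat \<omega>} = {\<omega> \<in> space Pr. (\<integral>z. f2 (K *\<^sub>v mf \<omega> + z) \<partial>Pxi)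
      \<le> (1 / real N) * (\<Sum>i<N. f2 (scenario (M N \<omega>) (Yf N \<omega>) (g \<omega>) i)) + Lobj * \<epsilon> \<omega>}"
    by (auto simp: J_eq Jhat_def program_cost_def dim_M)
  have "1 - \<alpha> \<le> Pr.prob {\<omega> \<in> space Pr. J \<omega> \<le> Jhat \<omega>}"
  proof -
    have "{\<omega> \<in> space Pr. J \<omega> \<le> Jhat \<omega>} \<in> Pr.events"
      unfolding J_set using f2_mean EJ_meas eps_meas by measurable
    \<comment> \<open>Feasibility holds almost surely, so the good event is compared with the target
      event up to a null set.\<close>
    moreover have "AE \<omega> in Pr. \<omega> \<in> E1 \<inter> E2 \<longrightarrow> \<omega> \<in> {\<omega> \<in> space Pr. J \<omega> \<le> Jhat \<omega>}"
      using feasible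
    proof eventually_elim
      case (elim \<omega>)
      then show ?case
        unfolding J_set using bound[OF _ _ assms(35) f2] by (auto simp: E1_def)
    qed
    ultimately have "Pr.prob (E1 \<inter> E2) \<le> Pr.prob {\<omega> \<in> space Pr. J \<omega> \<le> Jhat \<omega>}"
      by (intro Pr.finite_measure_mono_AE)
    then show ?thesis using good by simp
  qed
  moreover have "1 - \<alpha> \<le> Pr.prob {\<omega> \<in> space Pr. cvar (output_law K Pxi (mf \<omega>)) \<beta> h \<le> 0}"
  proof -
    have cvar_eq: "cvar (output_law K Pxi \<mu>) \<beta> h
        = (INF t. (1 / \<beta>) * (\<integral>z. max (h (K *\<^sub>v \<mu> + z) - t) 0 \<partial>Pxi) + t)" for \<mu>
      unfolding cvar_def
      by (intro INF_cong refl arg_cong2[of _ _ _ _ "(+)"] arg_cong2[of _ _ _ _ "(*)"] law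
          borel_measurable_lipschitz_vec[OF r lipschitz_vec_hinge[OF h]])
    have "(\<lambda>\<omega>. cvar (output_law K Pxi (mf \<omega>)) \<beta> h) \<in> borel_measurable Pr"
      unfolding cvar_eq
      by (rule measurable_compose_vec[where d = d and X = "\<lambda>\<omega>. K *\<^sub>v mf \<omega>"
            and f = "\<lambda>c. INF t. (1 / \<beta>) * (\<integral>z. max (h (c + z) - t) 0 \<partial>Pxi) + t",
            OF Q.measurable_cvar_translate[OF h assms(44)] Kmf Kmf_carrier])
    then have "{\<omega> \<in> space Pr. cvar (output_law K Pxi (mf \<omega>)) \<beta> h \<le> 0} \<in> Pr.events"
      by measurable
    moreover have "AE \<omega> in Pr. \<omega> \<in> E1 \<inter> E2 \<longrightarrow>
        \<omega> \<in> {\<omega> \<in> space Pr. cvar (output_law K Pxi (mf \<omega>)) \<beta> h \<le> 0}"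
      using feasible
    proof eventually_elim
      case (elim \<omega>)
      then obtain \<tau> s where feas: "program_feasible h \<U> \<beta> Lcon (\<epsilon> \<omega>) up yp
          (M N \<omega>) (Up N \<omega>) (Yp N \<omega>) (Uf N \<omega>) (Yf N \<omega>) (g \<omega>) \<tau> s" by blast
      have "cvar (output_law K Pxi (mf \<omega>)) \<beta> h \<le> 0" if \<omega>: "\<omega> \<in> E1 \<inter> E2"
      proof -
        define I where "I = (\<integral>z. max (h (K *\<^sub>v mf \<omega> + z) - (- \<tau>)) 0 \<partial>Pxi)"
        have s: "- \<tau> * \<beta> + Lcon * \<epsilon> \<omega> + (1 / real N) * (\<Sum>i<N. s $ i) \<le> 0"
          "\<And>i. i < N \<Longrightarrow> \<tau> + h (scenario (M N \<omega>) (Yf N \<omega>) (g \<omega>) i) \<le> s $ i \<and> 0 \<le> s $ i"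
          using feas by (simp_all add: program_feasible_def Let_def dim_M)
        have "(\<Sum>i<N. max (h (scenario (M N \<omega>) (Yf N \<omega>) (g \<omega>) i) - (- \<tau>)) 0) \<le> (\<Sum>i<N. s $ i)"
          using s(2) by (intro sum_mono) (force simp: add.commute)
        then have "(1 / real N) * (\<Sum>i<N. max (h (scenario (M N \<omega>) (Yf N \<omega>) (g \<omega>) i) - (- \<tau>)) 0)
            \<le> (1 / real N) * (\<Sum>i<N. s $ i)"
          by (intro mult_left_mono) auto
        \<comment> \<open>This test function varies with the realisation through
          \<open>\<tau>\<close>; that is admissible because \<open>bound\<close> covers all
          Lipschitz functions on the same event.\<close>
        moreover have "I \<le> (1 / real N) * (\<Sum>i<N. max (h (scenario (M N \<omega>) (Yf N \<omega>) (g \<omega>) i) - (- \<tau>)) 0) + Lcon * \<epsilon> \<omega>"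
          unfolding I_def by (rule bound[OF \<omega> feas assms(36) lipschitz_vec_hinge[OF h]])
        ultimately have "I \<le> \<tau> * \<beta>" using s(1) by linarith
        then have "(1 / \<beta>) * I + (- \<tau>) \<le> 0" using \<beta> by (simp add: field_simps)
        then show ?thesis
          unfolding cvar_eq I_def
          by (rule cINF_lower2[OF Q.bdd_below_cvar[OF h assms(44) Kmf_carrier] UNIV_I])
      qed
      then show ?case by (auto simp: E1_def)
    qed
    ultimately have "Pr.prob (E1 \<inter> E2) \<le> Pr.prob {\<omega> \<in> space Pr. cvar (output_law K Pxi (mf \<omega>)) \<beta> h \<le> 0}"
      by (intro Pr.finite_measure_mono_AE)
    then show ?thesis using good by simp
  qed
  ultimately show ?thesis by blast
qed

end
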